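(* Let $q\in\mathbb{C}$ with $\operatorname{Re} q>0$, and let $G_r\in\mathcal{J}_r$ with $r\ge\frac{6}{\operatorname{Re} q}$. Denote $\gamma_r:=\dfrac{1-A(r\operatorname{Re} q)}{1+A(r\operatorname{Re} q)}$. Then for the semigroup $\{u(t,\cdot)\}_{t\ge0}$ generated by $G_r$ the following assertions hold: (i) $\{u(t,\cdot)\}_{t\ge0}$ is exponentially squeezing with squeezing ratio $$\kappa(r):=\frac{\left(\operatorname{Re}(1+rq)^{\frac{1}{\gamma_r}}\right)^{\gamma_r}}{2^{1-\gamma_r}|1+rq|^2}$$ (so $u(t,\cdot)$ converges to $0$ as $t\to\infty$, uniformly on $\mathbb{D}$); (ii) for every $z\in\mathbb{D}$, $u(\cdot,z)$ can be analytically extended to the sector $$\left\{t\in\mathbb{C}:\ \left|\arg t-\arg(1+rq)\right|<\frac{\pi\gamma_r}{2}\right\}.$$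
   Context: $\mathbb{D}=\{z\in\mathbb{C}:|z|<1\}$. The function $A$ is defined by $A(x)=\dfrac{6x(1+x)}{(1+x)^3-3(5x-1)}$. A holomorphic function $g:\mathbb{D}\to\mathbb{C}$ is called a generator if for every $z\in\mathbb{D}$ the Cauchy problem $\frac{\partial u(t,z)}{\partial t}+g(u(t,z))=0$, $u(0,z)=z$, has a unique solution $u(t,z)\in\mathbb{D}$ defined for all $t\ge 0$; the family $\{u(t,\cdot)\}_{t\ge0}$ is then called the semigroup generated by $g$. For a generator $f$ and $r>0$, it is known that $(\mathrm{Id}+rf)(\mathbb{D})\supset\mathbb{D}$ and that $G_r:=(\mathrm{Id}+rf)^{-1}$ is a well-defined holomorphic (univalent) self-mapping of $\mathbb{D}$, called the nonlinear resolvent of $f$. When $f(0)=0$, it is known that $G_r$ is itself a generator. For fixed $q\in\mathbb{C}$ with $\operatorname{Re} q>0$ and $r>0$, $\mathcal{J}_r$ denotes the family of all resolvents $G_r=(\mathrm{Id}+rf)^{-1}$ of generators $f$ with $f(0)=0$ and $f'(0)=q$. A semigroup is exponentially squeezing with squeezing ratio $\kappa>0$ if $|u(t,z)|\le|z|e^{-\kappa t}$ for all $t>0$ and $z\in\mathbb{D}$.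
   Formalization: The squeezing ratio κ(r) in (i) is claimed only when |arg(1+rq)| < πγ_r/2; otherwise κ(r) may be undefined or non-positive, or the claim false (f(z)=qz, r Re q=6, arg(1+rq)=62π/127). Uniform convergence to 0 and (ii) are proved without this condition. *)

theory Defs
  imports "HOL-Complex_Analysis.Complex_Analysis"
begin

abbreviation unit_disc :: "complex set" where
  "unit_disc \<equiv> ball 0 1"

text \<open>A solution of the Cauchy problem is a function of the real time variable of which only the
  values on \<open>t \<ge> 0\<close> matter; the derivative at \<open>t = 0\<close> is one-sided.\<close>

definition cauchy_solution :: "(complex \<Rightarrow> complex) \<Rightarrow> complex \<Rightarrow> (real \<Rightarrow> complex) \<Rightarrow> bool" where
  "cauchy_solution g z v \<longleftrightarrow>
     v 0 = z \<and>
     (\<forall>t\<ge>0. v t \<in> unit_disc \<and> (v has_vector_derivative - g (v t)) (at t within {0..}))"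

definition generator :: "(complex \<Rightarrow> complex) \<Rightarrow> bool" where
  "generator g \<longleftrightarrow>
     g holomorphic_on unit_disc \<and>
     (\<forall>z\<in>unit_disc.
        (\<exists>v. cauchy_solution g z v) \<and>
        (\<forall>v w. cauchy_solution g z v \<longrightarrow> cauchy_solution g z w \<longrightarrow> (\<forall>t\<ge>0. v t = w t)))"

text \<open>The description ranges over the value at time \<open>t\<close>, since a solution is unique
  only up to its values at negative times.\<close>

definition generated_semigroup :: "(complex \<Rightarrow> complex) \<Rightarrow> real \<Rightarrow> complex \<Rightarrow> complex" where
  "generated_semigroup g t z = (THE y. \<exists>v. cauchy_solution g z v \<and> y = v t)"

definition nonlinear_resolvent :: "real \<Rightarrow> (complex \<Rightarrow> complex) \<Rightarrow> complex \<Rightarrow> complex" where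
  "nonlinear_resolvent r f = inv_into unit_disc (\<lambda>z. z + of_real r * f z)"

text \<open>The functions live on the unit disc, so their values outside it are left arbitrary.\<close>

definition resolvent_family :: "real \<Rightarrow> complex \<Rightarrow> (complex \<Rightarrow> complex) set" where
  "resolvent_family r q =
     {G. \<exists>f. generator f \<and> f 0 = 0 \<and> deriv f 0 = q \<and>
             (\<forall>w\<in>unit_disc. G w = nonlinear_resolvent r f w)}"

definition A_fun :: "real \<Rightarrow> real" where
  "A_fun x = 6 * x * (1 + x) / ((1 + x) ^ 3 - 3 * (5 * x - 1))"

definition gamma_r :: "real \<Rightarrow> complex \<Rightarrow> real" where
  "gamma_r r q = (1 - A_fun (r * Re q)) / (1 + A_fun (r * Re q))"

definition kappa_r :: "real \<Rightarrow> complex \<Rightarrow> real" where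
  "kappa_r r q =
     Re ((1 + of_real r * q) powr of_real (1 / gamma_r r q)) powr gamma_r r q /
     (2 powr (1 - gamma_r r q) * (cmod (1 + of_real r * q))\<^sup>2)"

definition exponentially_squeezing :: "(real \<Rightarrow> complex \<Rightarrow> complex) \<Rightarrow> real \<Rightarrow> bool" where
  "exponentially_squeezing u \<kappa> \<longleftrightarrow>
     \<kappa> > 0 \<and> (\<forall>t>0. \<forall>z\<in>unit_disc. cmod (u t z) \<le> cmod z * exp (- \<kappa> * t))"

text \<open>For \<open>\<bar>a\<bar> < pi / 2\<close> and \<open>h \<le> pi / 2\<close> the sector avoids the cut of the
  principal argument. The vertex is excluded by hand because \<open>Arg 0 = 0\<close>.\<close>

definition sector :: "real \<Rightarrow> real \<Rightarrow> complex set" where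
  "sector a h = {t. t \<noteq> 0 \<and> \<bar>Arg t - a\<bar> < h}"

text \<open>The function \<open>v\<close>, given on the positive half-line, continues analytically to \<open>S\<close>: a
  connected open set contains both the half-line and \<open>S\<close> and carries a holomorphic extension
  of \<open>v\<close>. When \<open>S\<close> is itself a domain containing the half-line, this just says that \<open>v\<close> is the
  restriction of a holomorphic function on \<open>S\<close>; when \<open>S\<close> misses the half-line, it is still not
  vacuous.\<close>

definition analytically_extends_to :: "(real \<Rightarrow> complex) \<Rightarrow> complex set \<Rightarrow> bool" where
  "analytically_extends_to v S \<longleftrightarrow>
     (\<exists>\<Omega> F. open \<Omega> \<and> connected \<Omega> \<and> S \<subseteq> \<Omega> \<and> complex_of_real ` {0<..} \<subseteq> \<Omega> \<and>
            F holomorphic_on \<Omega> \<and> (\<forall>t>0. F (of_real t) = v t))"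

end

theory Submission
  imports Defs
begin

text \<open>
  The resolvent has the form \<open>G z = z / N z\<close> with \<open>Re N \<ge> 1\<close>, and everything depends on how far
  \<open>N\<close> can deviate from its value \<open>a = 1 + r q\<close> at \<open>0\<close>.

  Write \<open>f z = z p z\<close>. Since the flow of \<open>f\<close> consists of holomorphic self-maps of the disc
  fixing \<open>0\<close>, the Schwarz lemma gives \<open>Re p \<ge> 0\<close> (\<open>generator_dissipative\<close>). The equation of the
  resolvent is \<open>G (1 + r p (G)) = id\<close>, so \<open>N = 1 + r p \<circ> G\<close>. By the Harnack bound for \<open>p\<close> the values of
  \<open>G\<close> lie in \<open>\<bar>z\<bar> < 1 / (x - 1)\<close> with \<open>x = r Re q\<close>, and on this small disc the Schwarz lemma for \<open>p\<close> yields
  \<open>N = a exp \<Lambda>\<close> with \<open>\<bar>\<Lambda>\<bar> \<le> 2 / (x - 2)\<close> (\<open>resolvent_as_quotient\<close>, \<open>half_plane_quotient_exp\<close>). For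
  \<open>x \<ge> 6\<close> the right side is at most \<open>ln 2 * (1 - \<gamma>)\<close> (\<open>A_fun_bounds\<close>).

  The semigroup generated by \<open>G\<close> is found by quadrature. For \<open>u = exp \<zeta>\<close> the equation reads
  \<open>\<Psi>(\<zeta>)' = - 1\<close>, where \<open>\<Psi>\<close> is a primitive of \<open>N (exp \<zeta>)\<close> on the left half-plane. As \<open>Re \<Psi>' \<ge> 1\<close>, the
  function \<open>\<Psi>\<close> is injective, and \<open>u = exp (\<Psi>\<inverse> (\<Psi> \<zeta>0 - t))\<close> makes sense for all complex \<open>t\<close> with
  \<open>\<Psi> \<zeta>0 - t\<close> in the image of \<open>\<Psi>\<close>. This includes the ray through \<open>d\<close> whenever \<open>Re (cnj d * N) > 0\<close>
  (\<open>holomorphic_flow\<close>), and \<open>N = a exp \<Lambda>\<close> shows this for all \<open>d\<close> in the sector of the theorem.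

  The modulus of an orbit decays at least like \<open>exp (- k t)\<close> if \<open>Re (1 / N) \<ge> k\<close>. A positive \<open>k\<close> exists
  because \<open>Re N \<ge> 1\<close> and \<open>N\<close> is bounded, whence the uniform convergence. If \<open>\<bar>Arg a\<bar> < pi \<gamma> / 2\<close>, then
  \<open>k\<close> may be taken to be \<open>\<kappa>\<close> (\<open>Re_inverse_lower_bound\<close>): \<open>(a / N)\<close> to the power \<open>1 / (1 - \<gamma>)\<close> lies in the
  half-plane \<open>Re \<ge> 1 / 2\<close>, and \<open>\<kappa>\<close> is the bound that this and the concavity of \<open>ln cos\<close> give.
\<close>

section \<open>Dependence of solutions on the initial value\<close>

text \<open>The difference quotient of \<open>g\<close>, written as the mean of \<open>g'\<close> over the segment so that it is
  jointly continuous also across the diagonal \<open>x = y\<close>.\<close>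

definition secant_slope :: "(complex \<Rightarrow> complex) \<Rightarrow> complex \<Rightarrow> complex \<Rightarrow> complex" where
  "secant_slope g x y = integral {0..1} (\<lambda>s. deriv g (y + of_real s * (x - y)))"

lemma segment_point_in_convex:
  fixes x y :: complex
  assumes "convex S" "x \<in> S" "y \<in> S" "0 \<le> s" "s \<le> 1"
  shows "y + of_real s * (x - y) \<in> S"
  using convexD_alt[OF assms(1) assms(3) assms(2) assms(4,5)]
  by (simp add: scaleR_conv_of_real algebra_simps)

lemma continuous_on_secant_slope:
  assumes "g holomorphic_on S" "open S" "convex S"
  shows "continuous_on (S \<times> S) (\<lambda>p. secant_slope g (fst p) (snd p))"
proof -
  have "continuous_on S (deriv g)"
    using assms by (intro holomorphic_on_imp_continuous_on holomorphic_deriv)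
  then have "continuous_on ((S \<times> S) \<times> cbox 0 (1::real))
          (\<lambda>(p, s). deriv g (snd p + of_real s * (fst p - snd p)))"
    unfolding case_prod_unfold
    by (rule continuous_on_compose2)
      (auto intro!: continuous_intros segment_point_in_convex[OF assms(3)])
  then show ?thesis
    unfolding secant_slope_def interval_cbox by (rule integral_continuous_on_param)
qed

lemma diff_eq_mult_secant_slope:
  assumes "g holomorphic_on S" "open S" "convex S" "x \<in> S" "y \<in> S"
  shows "g x - g y = (x - y) * secant_slope g x y"
proof -
  let ?l = "\<lambda>s::real. y + of_real s * (x - y)"
  have l: "?l s \<in> S" if "s \<in> {0..1}" for s
    using segment_point_in_convex[OF assms(3,4,5)] that by auto
  have "((\<lambda>s. deriv g (?l s) * (x - y)) has_integral g (?l 1) - g (?l 0)) {0..1}"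
  proof (rule fundamental_theorem_of_calculus)
    fix s :: real assume s: "s \<in> {0..1}"
    have d: "(g has_field_derivative deriv g (?l s)) (at (?l s))"
      using assms(1,2) l[OF s] by (rule holomorphic_derivI)
    have "(?l has_vector_derivative (x - y)) (at s)"
      by (auto intro!: derivative_eq_intros)
    from field_vector_diff_chain_at[OF this d]
    have "((\<lambda>s. g (?l s)) has_vector_derivative ((x - y) * deriv g (?l s))) (at s)"
      by (simp add: o_def)
    then show "((\<lambda>s. g (?l s)) has_vector_derivative (deriv g (?l s) * (x - y))) (at s within {0..1})"
      by (simp add: mult.commute has_vector_derivative_at_within)
  qed auto
  moreover have "continuous_on {0..1} (\<lambda>s. deriv g (?l s))"
    using l by (intro continuous_on_compose2[OF holomorphic_on_imp_continuous_on[OF holomorphic_deriv[OF assms(1,2)]]])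
      (auto intro!: continuous_intros)
  then have "((\<lambda>s. deriv g (?l s) * (x - y)) has_integral secant_slope g x y * (x - y)) {0..1}"
    unfolding secant_slope_def
    by (intro has_integral_mult_left integrable_integral integrable_continuous_interval)
  ultimately show ?thesis
    by (auto dest: has_integral_unique simp: mult.commute)
qed

lemma cauchy_solution_continuous:
  assumes "cauchy_solution g z v" "A \<subseteq> {0..}"
  shows "continuous_on A v"
proof (rule continuous_on_subset[OF _ assms(2)])
  show "continuous_on {0..} v"
    using assms(1) unfolding cauchy_solution_def
    by (auto intro: continuous_on_vector_derivative)
qed

text \<open>The difference of two solutions solves a linear equation whose coefficient is the secant slope
  of \<open>g\<close>, so it is given by an exponential. This single formula yields uniqueness, Lipschitz dependence
  on the initial value, and, by passage to the limit, differentiability in the initial value.\<close>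

lemma cauchy_solution_difference:
  assumes g: "g holomorphic_on unit_disc"
    and v: "cauchy_solution g z v" and w: "cauchy_solution g y w" and t: "t \<ge> 0"
  shows "v t - w t = (z - y) * exp (- integral {0..t} (\<lambda>s. secant_slope g (v s) (w s)))"
proof -
  let ?A = "\<lambda>s. secant_slope g (v s) (w s)"
  let ?I = "\<lambda>s. integral {0..s} ?A"
  have in_disc: "v s \<in> unit_disc" "w s \<in> unit_disc" if "s \<ge> 0" for s
    using v w that by (auto simp: cauchy_solution_def)
  have "continuous_on {0..t} (\<lambda>s. (v s, w s))"
    using cauchy_solution_continuous[OF v, of "{0..t}"] cauchy_solution_continuous[OF w, of "{0..t}"]
    by (auto intro!: continuous_intros)
  then have contA: "continuous_on {0..t} ?A"
    using continuous_on_compose2[OF continuous_on_secant_slope[OF g open_ball convex_ball],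
        of "{0..t}" "\<lambda>s. (v s, w s)"] in_disc by fastforce
  have "(v t - w t) * exp (?I t) = (v 0 - w 0) * exp (?I 0)"
  proof (rule has_derivative_zero_unique[of "{0..t}" "\<lambda>s. (v s - w s) * exp (?I s)"])
    fix s assume s: "s \<in> {0..t}"
    have dv: "(v has_vector_derivative - g (v s)) (at s within {0..t})"
      and dw: "(w has_vector_derivative - g (w s)) (at s within {0..t})"
      using v w s unfolding cauchy_solution_def
      by (auto intro!: has_vector_derivative_within_subset[where S="{0..}" and T="{0..t}"])
    have "(?I has_vector_derivative ?A s) (at s within {0..t})"
      by (rule integral_has_vector_derivative[OF contA s])
    then have dI: "((\<lambda>s. exp (?I s)) has_vector_derivative ?A s * exp (?I s)) (at s within {0..t})"
      using field_vector_diff_chain_within[OF _ DERIV_subset[OF DERIV_exp]]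
      by (fastforce simp: o_def)
    have "((\<lambda>s. (v s - w s) * exp (?I s)) has_vector_derivative
            (v s - w s) * (?A s * exp (?I s)) + (- g (v s) - - g (w s)) * exp (?I s)) (at s within {0..t})"
      by (intro has_vector_derivative_mult has_vector_derivative_diff dv dw dI)
    moreover have "(v s - w s) * (?A s * exp (?I s)) + (- g (v s) - - g (w s)) * exp (?I s) =
        ((v s - w s) * ?A s - (g (v s) - g (w s))) * exp (?I s)"
      by (simp add: algebra_simps)
    moreover have "g (v s) - g (w s) = (v s - w s) * ?A s"
      using in_disc s by (intro diff_eq_mult_secant_slope[OF g]) auto
    ultimately show "((\<lambda>s. (v s - w s) * exp (?I s)) has_derivative (\<lambda>h. 0)) (at s within {0..t})"
      by (simp add: has_vector_derivative_def)
  qed (use t in auto)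
  moreover have "v 0 = z" "w 0 = y"
    using v w by (auto simp: cauchy_solution_def)
  ultimately show ?thesis
    by (simp add: exp_minus field_simps)
qed

lemma cauchy_solution_unique:
  assumes "g holomorphic_on unit_disc"
    and "cauchy_solution g z v" and "cauchy_solution g z w" and "t \<ge> 0"
  shows "v t = w t"
  using cauchy_solution_difference[OF assms] by simp

lemma generated_semigroup_eq:
  assumes "g holomorphic_on unit_disc" "cauchy_solution g z v" "t \<ge> 0"
  shows "generated_semigroup g t z = v t"
  unfolding generated_semigroup_def
  using assms cauchy_solution_unique by (intro the_equality) blast+

text \<open>Orbits starting near \<open>z0\<close> remain during \<open>[0, T]\<close> in one compact subdisc and are
  uniformly close to the orbit of \<open>z0\<close>. As long as they remain there, the formula for the difference
  gives a bound with the maximum of the secant slope on the subdisc, and this bound in turn keeps them there.\<close>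

lemma flow_Lipschitz_in_initial_value:
  assumes g: "g holomorphic_on unit_disc"
    and V: "\<And>z. z \<in> unit_disc \<Longrightarrow> cauchy_solution g z (V z)"
    and z0: "z0 \<in> unit_disc" and T: "T \<ge> 0"
  obtains \<rho> C where "0 < \<rho>" "\<rho> < 1" "0 < C" "\<And>s. s \<in> {0..T} \<Longrightarrow> V z0 s \<in> cball 0 \<rho>"
    "\<forall>\<^sub>F z in at z0. z \<in> unit_disc \<and>
       (\<forall>s\<in>{0..T}. V z s \<in> cball 0 \<rho> \<and> cmod (V z s - V z0 s) \<le> C * cmod (z - z0))"
proof -
  have in_disc: "V z s \<in> unit_disc" if "z \<in> unit_disc" "s \<ge> 0" for z s
    using V[OF that(1)] that(2) by (auto simp: cauchy_solution_def)
  have cont: "continuous_on {0..T} (V z)" if "z \<in> unit_disc" for z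
    using cauchy_solution_continuous[OF V[OF that]] by auto
  \<comment> \<open>The orbit of \<open>z0\<close> over \<open>[0, T]\<close> stays at distance at least \<open>\<epsilon>\<close> from the circle of radius
    \<open>\<rho>\<close>, which leaves room for neighbouring orbits.\<close>
  obtain m where m: "m \<in> {0..T}" "\<And>s. s \<in> {0..T} \<Longrightarrow> cmod (V z0 s) \<le> cmod (V z0 m)"
    using continuous_attains_sup[of "{0..T}" "\<lambda>s. cmod (V z0 s)", OF _ _ continuous_on_norm[OF cont[OF z0]]] T
    by auto
  define \<epsilon> where "\<epsilon> = (1 - cmod (V z0 m)) / 2"
  define \<rho> where "\<rho> = 1 - \<epsilon>"
  have \<epsilon>: "\<epsilon> > 0" and \<rho>: "0 < \<rho>" "\<rho> < 1" "cmod (V z0 m) + \<epsilon> = \<rho>"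
    using in_disc[OF z0, of m] m(1) norm_ge_zero[of "V z0 m"]
    by (auto simp: \<epsilon>_def \<rho>_def field_simps simp del: norm_ge_zero)
  have V0: "V z0 s \<in> cball 0 \<rho>" if "s \<in> {0..T}" for s
    using m(2)[OF that] \<rho> \<epsilon> by auto
  have sub: "cball 0 \<rho> \<subseteq> unit_disc"
    using \<rho> by auto
  have "compact ((\<lambda>p. secant_slope g (fst p) (snd p)) ` (cball 0 \<rho> \<times> cball 0 \<rho>))"
    by (intro compact_continuous_image compact_Times compact_cball
        continuous_on_subset[OF continuous_on_secant_slope[OF g open_ball convex_ball]])
       (use sub in auto)
  from compact_imp_bounded[OF this] obtain L where L: "L > 0"
    "\<And>x y. x \<in> cball 0 \<rho> \<Longrightarrow> y \<in> cball 0 \<rho> \<Longrightarrow> cmod (secant_slope g x y) \<le> L"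
    unfolding bounded_pos by fastforce
  define C where "C = exp (L * T)"
  have C: "C > 0" "C \<ge> 1"
    using L T by (auto simp: C_def)
  have close: "cmod (V z s - V z0 s) \<le> C * cmod (z - z0)"
    if z: "z \<in> unit_disc" and s: "s \<in> {0..T}" and stay: "\<And>\<tau>. \<tau> \<in> {0..<s} \<Longrightarrow> V z \<tau> \<in> cball 0 \<rho>" for z s
  proof -
    let ?A = "\<lambda>\<tau>. secant_slope g (V z \<tau>) (V z0 \<tau>)"
    have "continuous_on {0..s} (\<lambda>\<tau>. (V z \<tau>, V z0 \<tau>))"
      using continuous_on_subset[OF cont[OF z], of "{0..s}"] continuous_on_subset[OF cont[OF z0], of "{0..s}"] s
      by (auto intro!: continuous_intros)
    then have contA: "continuous_on {0..s} ?A"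
      using continuous_on_compose2[OF continuous_on_secant_slope[OF g open_ball convex_ball],
          of "{0..s}" "\<lambda>\<tau>. (V z \<tau>, V z0 \<tau>)"] in_disc z z0 by fastforce
    have "closed {\<tau> \<in> {0..s}. cmod (?A \<tau>) \<le> L}"
      by (intro continuous_on_closed_Collect_le contA continuous_intros)
    moreover have "{0..<s} \<subseteq> {\<tau> \<in> {0..s}. cmod (?A \<tau>) \<le> L}"
      using stay V0 s by (auto intro!: L(2))
    ultimately have "closure {0..<s} \<subseteq> {\<tau> \<in> {0..s}. cmod (?A \<tau>) \<le> L}"
      by (intro closure_minimal)
    then have A_le: "cmod (?A \<tau>) \<le> L" if "\<tau> \<in> {0..s}" "s > 0" for \<tau>
      using that by auto
    have "cmod (integral {0..s} ?A) \<le> L * s"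
    proof (cases "s > 0")
      case True
      then show ?thesis
        using integral_bound[of 0 s ?A L] contA A_le by auto
    qed (use s in auto)
    also have "\<dots> \<le> L * T"
      using L s by (intro mult_left_mono) auto
    finally have "- Re (integral {0..s} ?A) \<le> L * T"
      using abs_Re_le_cmod[of "integral {0..s} ?A"] by linarith
    then have "cmod (exp (- integral {0..s} ?A)) \<le> C"
      by (simp add: C_def)
    then have "cmod (z - z0) * cmod (exp (- integral {0..s} ?A)) \<le> cmod (z - z0) * C"
      by (rule mult_left_mono) simp
    then show ?thesis
      using cauchy_solution_difference[OF g V[OF z] V[OF z0], of s] s
      by (simp add: norm_mult mult.commute del: norm_exp_eq_Re)
  qed
  \<comment> \<open>At the first time at which the two orbits are \<open>\<epsilon>\<close> apart the estimate still applies, and it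
    says that they are closer than \<open>\<epsilon>\<close>.\<close>
  have stay: "V z s \<in> cball 0 \<rho>"
    if z: "z \<in> unit_disc" and near: "C * cmod (z - z0) < \<epsilon>" and s: "s \<in> {0..T}" for z s
  proof (rule ccontr)
    assume bad: "V z s \<notin> cball 0 \<rho>"
    let ?B = "{\<tau> \<in> {0..T}. cmod (V z \<tau> - V z0 \<tau>) \<ge> \<epsilon>}"
    have le: "V z \<tau> \<in> cball 0 \<rho>" if "\<tau> \<in> {0..T}" "\<tau> \<notin> ?B" for \<tau>
      using that m(2)[OF that(1)] norm_triangle_sub[of "V z \<tau>" "V z0 \<tau>"] \<rho> by auto
    have "closed ?B"
      by (intro continuous_on_closed_Collect_le continuous_intros cont z z0)
    then have "compact ?B"
      using bounded_subset[OF compact_imp_bounded[OF compact_Icc[of 0 T]], of ?B]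
      unfolding compact_eq_bounded_closed by blast
    moreover have "s \<in> ?B"
      using le s bad by blast
    ultimately obtain b where b: "b \<in> ?B" "\<And>\<tau>. \<tau> \<in> ?B \<Longrightarrow> b \<le> \<tau>"
      using compact_attains_inf[of ?B] by blast
    have "cmod (V z b - V z0 b) \<le> C * cmod (z - z0)"
    proof (rule close[OF z])
      show "V z \<tau> \<in> cball 0 \<rho>" if "\<tau> \<in> {0..<b}" for \<tau>
      proof (rule le)
        show "\<tau> \<in> {0..T}"
          using that b(1) by auto
        show "\<tau> \<notin> ?B"
          using b(2)[of \<tau>] that by auto
      qed
    qed (use b in auto)
    then show False
      using b(1) near by auto
  qed
  have "\<forall>\<^sub>F z in at z0. z \<in> unit_disc \<and> dist z z0 < \<epsilon> / C"
    using eventually_at_in_open'[OF open_ball, of z0 0 1] z0 \<epsilon> C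
      eventually_at_in_open'[OF open_ball, of z0 z0 "\<epsilon> / C"]
    by (auto elim: eventually_elim2 simp: dist_commute)
  then have "\<forall>\<^sub>F z in at z0. z \<in> unit_disc \<and>
       (\<forall>s\<in>{0..T}. V z s \<in> cball 0 \<rho> \<and> cmod (V z s - V z0 s) \<le> C * cmod (z - z0))"
  proof eventually_elim
    case (elim z)
    then have "C * cmod (z - z0) < \<epsilon>"
      using C by (simp add: dist_norm field_simps)
    with elim show ?case
      using stay close by auto
  qed
  then show ?thesis
    using that \<rho> C V0 by blast
qed

text \<open>Divided by \<open>z - z0\<close>, the difference of two orbits is the exponential of an integral, whose
  integrand converges uniformly as \<open>z \<rightarrow> z0\<close>. So the difference quotients of the time-\<open>T\<close> map converge.\<close>

lemma flow_holomorphic: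
  assumes g: "g holomorphic_on unit_disc"
    and V: "\<And>z. z \<in> unit_disc \<Longrightarrow> cauchy_solution g z (V z)"
    and T: "T \<ge> 0"
  shows "(\<lambda>z. V z T) holomorphic_on unit_disc"
  unfolding holomorphic_on_open[OF open_ball]
proof (intro ballI)
  fix z0 :: complex assume z0: "z0 \<in> unit_disc"
  obtain \<rho> C where \<rho>: "0 < \<rho>" "\<rho> < 1" "0 < C" "\<And>s. s \<in> {0..T} \<Longrightarrow> V z0 s \<in> cball 0 \<rho>"
    and ev: "\<forall>\<^sub>F z in at z0. z \<in> unit_disc \<and>
       (\<forall>s\<in>{0..T}. V z s \<in> cball 0 \<rho> \<and> cmod (V z s - V z0 s) \<le> C * cmod (z - z0))"
    using flow_Lipschitz_in_initial_value[OF g V z0 T] by blast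
  have sub: "cball 0 \<rho> \<subseteq> unit_disc"
    using \<rho> by auto
  let ?S = "\<lambda>p. secant_slope g (fst p) (snd p)"
  let ?K = "cball 0 \<rho> \<times> cball 0 \<rho>"
  let ?A = "\<lambda>z s. secant_slope g (V z s) (V z0 s)"
  have contS: "continuous_on ?K ?S"
    by (rule continuous_on_subset[OF continuous_on_secant_slope[OF g open_ball convex_ball]])
       (use sub in auto)
  have uc: "uniformly_continuous_on ?K ?S"
    by (intro compact_uniformly_continuous contS compact_Times compact_cball)
  have "uniform_limit {0..T} (\<lambda>z s. (V z s, V z0 s)) (\<lambda>s. (V z0 s, V z0 s)) (at z0)"
  proof (rule uniform_limitI)
    fix e :: real assume e: "e > 0"
    have "\<forall>\<^sub>F z in at z0. dist z z0 < e / C"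
      using e \<rho> eventually_at_in_open'[OF open_ball, of z0 z0 "e / C"] by (auto simp: dist_commute)
    with ev show "\<forall>\<^sub>F z in at z0. \<forall>s\<in>{0..T}. dist (V z s, V z0 s) (V z0 s, V z0 s) < e"
    proof eventually_elim
      case (elim z)
      then have "C * cmod (z - z0) < e"
        using \<rho> by (simp add: dist_norm field_simps)
      with elim show ?case
        by (auto simp: dist_Pair_Pair dist_norm intro: le_less_trans)
    qed
  qed
  then have "uniform_limit {0..T} (\<lambda>z s. ?S (V z s, V z0 s)) (\<lambda>s. ?S (V z0 s, V z0 s)) (at z0)"
    by (rule uniform_limit_compose_uniformly_continuous_on[OF _ uc])
       (use ev \<rho>(4) in \<open>auto elim!: eventually_mono intro: closed_Times\<close>)
  then have lim: "uniform_limit {0..T} ?A (?A z0) (at z0)"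
    by simp
  have contA: "continuous_on {0..T} (?A z)" if z: "z \<in> unit_disc" for z
  proof -
    have "continuous_on {0..T} (\<lambda>s. (V z s, V z0 s))"
      using cauchy_solution_continuous[OF V[OF z]] cauchy_solution_continuous[OF V[OF z0]]
      by (auto intro!: continuous_intros)
    then show ?thesis
      using continuous_on_compose2[OF continuous_on_secant_slope[OF g open_ball convex_ball],
          of "{0..T}" "\<lambda>s. (V z s, V z0 s)"] V[OF z] V[OF z0]
      by (fastforce simp: cauchy_solution_def)
  qed
  \<comment> \<open>Outside the disc the integrand is reset to its limit, which makes it continuous for every \<open>z\<close>.\<close>
  define B where "B z = (if z \<in> unit_disc then ?A z else ?A z0)" for z
  have "uniform_limit {0..T} B (?A z0) (at z0)"
    by (rule uniform_limit_cong[THEN iffD1, OF _ _ lim])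
       (use ev in \<open>auto elim!: eventually_mono simp: B_def\<close>)
  then obtain I J where IJ: "\<And>z. (B z has_integral I z) {0..T}" "(?A z0 has_integral J) {0..T}"
      "(I \<longlongrightarrow> J) (at z0)"
    by (rule uniform_limit_integral) (use contA z0 in \<open>auto simp: B_def\<close>)
  have I: "I z = integral {0..T} (?A z)" if "z \<in> unit_disc" for z
    using IJ(1)[of z] that by (simp add: B_def integral_unique)
  have "((\<lambda>z. exp (- I z)) \<longlongrightarrow> exp (- J)) (at z0)"
    by (intro tendsto_intros IJ)
  moreover have "\<forall>\<^sub>F z in at z0. exp (- I z) = (V z T - V z0 T) / (z - z0)"
    using eventually_conj[OF eventually_at_in_open'[OF open_ball z0] eventually_neq_at_within[of z0 z0 UNIV]]
  proof eventually_elim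
    case (elim z)
    then show ?case
      using cauchy_solution_difference[OF g V[of z] V[OF z0] T] I[of z] by (simp add: field_simps)
  qed
  ultimately have "((\<lambda>z. (V z T - V z0 T) / (z - z0)) \<longlongrightarrow> exp (- J)) (at z0)"
    by (rule Lim_transform_eventually)
  then have "((\<lambda>z. V z T) has_field_derivative exp (- J)) (at z0)"
    by (simp add: has_field_derivative_iff)
  then show "\<exists>D. ((\<lambda>z. V z T) has_field_derivative D) (at z0)" ..
qed

section \<open>Dissipativity of generators\<close>

text \<open>The strict bound of the Schwarz lemma is restored by a factor \<open>c < 1\<close>, which then tends to \<open>1\<close>.
  The Cayley transform of a function with \<open>Re \<ge> 0\<close> is known a priori to satisfy only the weak bound.\<close>

lemma Schwarz_Lemma_nonstrict:
  assumes "f holomorphic_on unit_disc" "f 0 = 0" "\<And>z. z \<in> unit_disc \<Longrightarrow> cmod (f z) \<le> 1"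
    and "z \<in> unit_disc"
  shows "cmod (f z) \<le> cmod z"
proof (rule field_le_mult_one_interval)
  fix c :: real assume c: "0 < c" "c < 1"
  have "cmod (of_real c * f z) \<le> cmod z"
  proof (rule Schwarz_Lemma(1))
    show "(\<lambda>z. of_real c * f z) holomorphic_on ball 0 1"
      by (intro holomorphic_intros assms)
    fix z :: complex assume "norm z < 1"
    then have "c * cmod (f z) \<le> c * 1"
      using assms(3)[of z] c by (intro mult_left_mono) auto
    moreover have "cmod (of_real c * f z) = c * cmod (f z)"
      using c by (simp add: norm_mult)
    ultimately show "cmod (of_real c * f z) < 1"
      using c by linarith
  qed (use assms in auto)
  then show "c * cmod (f z) \<le> cmod z"
    using c by (simp add: norm_mult)
qed

text \<open>A time-\<open>t\<close> map is a holomorphic self-map of the disc that fixes \<open>0\<close>, hence it does not increase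
  the modulus; the derivative of \<open>\<bar>u\<bar>\<^sup>2\<close> at \<open>t = 0\<close> is therefore nonpositive.\<close>

lemma generator_dissipative:
  assumes "generator f" "f 0 = 0" "z \<in> unit_disc"
  shows "Re (cnj z * f z) \<ge> 0"
proof -
  have f: "f holomorphic_on unit_disc"
    using assms by (simp add: generator_def)
  obtain V where V: "\<And>z. z \<in> unit_disc \<Longrightarrow> cauchy_solution f z (V z)"
    using assms(1) unfolding generator_def by metis
  have zero: "cauchy_solution f 0 (\<lambda>_. 0)"
    using assms(2) by (simp add: cauchy_solution_def)
  have shrink: "cmod (V z t) \<le> cmod z" if t: "t \<ge> 0" for t
  proof (rule Schwarz_Lemma_nonstrict[of "\<lambda>z. V z t"])
    show "(\<lambda>z. V z t) holomorphic_on unit_disc"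
      by (rule flow_holomorphic[OF f V t])
    show "V 0 t = 0"
      using cauchy_solution_unique[OF f V[of 0] zero t] by simp
    show "cmod (V w t) \<le> 1" if "w \<in> unit_disc" for w
      using V[OF that] t by (simp add: cauchy_solution_def less_imp_le)
  qed (use assms in auto)
  let ?v = "V z"
  have v: "(?v has_vector_derivative - f z) (at 0 within {0..})" "?v 0 = z"
    using V[OF assms(3)] by (auto simp: cauchy_solution_def)
  have "((\<lambda>t. (cmod (?v t))\<^sup>2) has_real_derivative 2 * (z \<bullet> (- f z))) (at 0 within {0..})"
  proof -
    have "((\<lambda>t. ?v t \<bullet> ?v t) has_derivative (\<lambda>h. ?v 0 \<bullet> (h *\<^sub>R (- f z)) + (h *\<^sub>R (- f z)) \<bullet> ?v 0)) (at 0 within {0..})"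
      using v(1) unfolding has_vector_derivative_def by (intro has_derivative_inner) 
    then show ?thesis
      unfolding has_field_derivative_def v(2) power2_norm_eq_inner
      by (rule has_derivative_eq_rhs) (auto simp: inner_commute)
  qed
  then have lim: "((\<lambda>t. ((cmod (?v t))\<^sup>2 - (cmod (?v 0))\<^sup>2) / (t - 0)) \<longlongrightarrow> 2 * (z \<bullet> (- f z))) (at 0 within {0..})"
    by (simp add: has_field_derivative_iff)
  have "2 * (z \<bullet> (- f z)) \<le> 0"
  proof (rule tendsto_upperbound[OF lim])
    show "\<forall>\<^sub>F t in at 0 within {0..}. ((cmod (?v t))\<^sup>2 - (cmod (?v 0))\<^sup>2) / (t - 0) \<le> 0"
      unfolding eventually_at_filter
      using shrink v(2) by (intro always_eventually) (auto intro!: divide_nonpos_nonneg power_mono)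
    show "at (0::real) within {0..} \<noteq> bot"
      by (simp add: at_within_Ici_at_right)
  qed
  then show ?thesis
    by (simp add: inner_complex_def)
qed

section \<open>Nonlinear resolvents\<close>

lemma dissipative_factorization:
  assumes "generator f" "f 0 = 0" "Re (deriv f 0) > 0"
  obtains p where "p holomorphic_on unit_disc" "p 0 = deriv f 0"
    "\<And>z. z \<in> unit_disc \<Longrightarrow> f z = z * p z" "\<And>z. z \<in> unit_disc \<Longrightarrow> Re (p z) \<ge> 0"
proof -
  have "f holomorphic_on unit_disc"
    using assms by (simp add: generator_def)
  then obtain p where p: "p holomorphic_on unit_disc" "\<And>z. norm z < 1 \<Longrightarrow> f z = z * p z" "deriv f 0 = p 0"
    using Schwarz3[of f 1] assms(2) by metis
  have "Re (p z) \<ge> 0" if z: "z \<in> unit_disc" for z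
  proof (cases "z = 0")
    case True
    then show ?thesis
      using assms(3) p(3) by simp
  next
    case False
    have "0 \<le> Re (cnj z * f z)"
      by (rule generator_dissipative[OF assms(1,2) z])
    also have "cnj z * f z = of_real ((cmod z)\<^sup>2) * p z"
      unfolding complex_norm_square using p(2)[of z] z by simp
    finally show ?thesis
      using False by (simp add: zero_le_mult_iff)
  qed
  then show ?thesis
    using that[OF p(1) p(3)[symmetric]] p(2) by simp
qed

text \<open>The Schwarz lemma for the Cayley transform \<open>\<eta> = (p - p 0) / (p + cnj (p 0))\<close>, solved for \<open>p\<close>.\<close>

lemma Schwarz_right_half_plane:
  assumes p: "p holomorphic_on unit_disc" "\<And>z. z \<in> unit_disc \<Longrightarrow> Re (p z) \<ge> 0"
    and q: "Re (p 0) > 0" and z: "z \<in> unit_disc"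
  obtains \<eta> where "cmod \<eta> \<le> cmod z" "p z * (1 - \<eta>) = p 0 + cnj (p 0) * \<eta>"
proof -
  have nz: "p w + cnj (p 0) \<noteq> 0" if "w \<in> unit_disc" for w
  proof
    assume "p w + cnj (p 0) = 0"
    then have "Re (p w + cnj (p 0)) = 0"
      by simp
    then show False
      using p(2)[OF that] q by simp
  qed
  define \<eta> where "\<eta> w = (p w - p 0) / (p w + cnj (p 0))" for w
  have "cmod (\<eta> z) \<le> cmod z"
  proof (rule Schwarz_Lemma_nonstrict[OF _ _ _ z])
    show "\<eta> holomorphic_on unit_disc"
      unfolding \<eta>_def by (intro holomorphic_intros p nz)
    show "cmod (\<eta> w) \<le> 1" if "w \<in> unit_disc" for w
    proof -
      have "(cmod (p w + cnj (p 0)))\<^sup>2 - (cmod (p w - p 0))\<^sup>2 = 4 * Re (p w) * Re (p 0)"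
        unfolding cmod_power2 by (simp add: power2_eq_square algebra_simps)
      also have "\<dots> \<ge> 0"
        using p(2)[OF that] q by simp
      finally have "(cmod (p w - p 0))\<^sup>2 \<le> (cmod (p w + cnj (p 0)))\<^sup>2"
        by (simp only: diff_ge_0_iff_ge)
      then have "cmod (p w - p 0) \<le> cmod (p w + cnj (p 0))"
        by (rule power2_le_imp_le) simp
      then show ?thesis
        using nz[OF that] by (simp add: \<eta>_def norm_divide)
    qed
  qed (simp add: \<eta>_def)
  moreover have "p z * (1 - \<eta> z) = p 0 + cnj (p 0) * \<eta> z"
    using nz[OF z] by (simp add: \<eta>_def field_simps)
  ultimately show ?thesis
    using that by blast
qed

lemma Harnack_lower_bound:
  assumes p: "p holomorphic_on unit_disc" "\<And>z. z \<in> unit_disc \<Longrightarrow> Re (p z) \<ge> 0"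
    and q: "Re (p 0) > 0" and z: "z \<in> unit_disc"
  shows "Re (p z) * (1 + cmod z) \<ge> Re (p 0) * (1 - cmod z)"
proof -
  obtain \<eta> where \<eta>: "cmod \<eta> \<le> cmod z" "p z * (1 - \<eta>) = p 0 + cnj (p 0) * \<eta>"
    by (rule Schwarz_right_half_plane[OF assms])
  have "Re (p z) * (cmod (1 - \<eta>))\<^sup>2 = Re (p z * (1 - \<eta>) * cnj (1 - \<eta>))"
    unfolding cmod_power2 by (simp add: power2_eq_square algebra_simps)
  also have "\<dots> = Re (p 0) * (1 - (cmod \<eta>)\<^sup>2)"
    unfolding \<eta>(2) cmod_power2 by (simp add: power2_eq_square algebra_simps)
  finally have eq: "Re (p z) * (cmod (1 - \<eta>))\<^sup>2 = Re (p 0) * ((1 - cmod \<eta>) * (1 + cmod \<eta>))"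
    by (simp add: power2_eq_square algebra_simps)
  have "cmod (1 - \<eta>) \<le> 1 + cmod \<eta>"
    using norm_triangle_ineq4[of 1 \<eta>] by simp
  then have "(cmod (1 - \<eta>))\<^sup>2 \<le> (1 + cmod \<eta>)\<^sup>2"
    by (intro power_mono) auto
  then have "Re (p 0) * (1 - cmod \<eta>) * (1 + cmod \<eta>) \<le> Re (p z) * (1 + cmod \<eta>) * (1 + cmod \<eta>)"
    using eq mult_left_mono[of _ _ "Re (p z)", OF _ p(2)[OF z]]
    unfolding power2_eq_square mult.assoc by metis
  then have "Re (p 0) * (1 - cmod \<eta>) \<le> Re (p z) * (1 + cmod \<eta>)"
    by (rule mult_right_le_imp_le) (simp add: add_pos_nonneg)
  also have "\<dots> \<le> Re (p z) * (1 + cmod z)"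
    using \<eta>(1) p(2)[OF z] by (intro mult_left_mono) auto
  finally have "Re (p 0) * (1 - cmod \<eta>) \<le> Re (p z) * (1 + cmod z)" .
  moreover have "Re (p 0) * (1 - cmod z) \<le> Re (p 0) * (1 - cmod \<eta>)"
    using \<eta>(1) q by (intro mult_left_mono) auto
  ultimately show ?thesis
    by (rule order_trans[rotated])
qed

text \<open>A Moebius map moves \<open>a\<close> to \<open>0\<close>; a second fixed point is then a case of equality in the Schwarz
  lemma.\<close>

lemma fixed_point_unique:
  assumes T: "T holomorphic_on unit_disc" "\<And>z. z \<in> unit_disc \<Longrightarrow> T z \<in> cball 0 \<rho>" "\<rho> < 1"
    and ab: "a \<in> unit_disc" "b \<in> unit_disc" "T a = a" "T b = b"
  shows "a = b"
proof (rule ccontr)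
  assume "a \<noteq> b"
  let ?M = "Moebius_function 0"
  have a: "cmod a < 1" "cmod (- a) < 1"
    using ab by auto
  have Mn: "cmod (?M c z) < 1" if "cmod c < 1" "cmod z < 1" for c z
    by (rule Moebius_function_norm_lt_1[OF that])
  have inv: "?M (- a) (?M a z) = z" if "cmod z < 1" for z
    using Moebius_function_compose[of "-a" a z] a that by auto
  have T1: "cmod (T z) < 1" if "cmod z < 1" for z
    using T(2)[of z] T(3) that by auto
  define S where "S z = ?M a (T (?M (- a) z))" for z
  have hol: "S holomorphic_on ball 0 1"
    unfolding S_def
    by (rule holomorphic_on_compose_gen[unfolded o_def, OF holomorphic_on_compose_gen[unfolded o_def,
          OF Moebius_function_holomorphic[OF a(2)] T(1)] Moebius_function_holomorphic[OF a(1)]])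
       (use Mn a T1 in auto)
  have S0: "S 0 = 0"
    using ab by (simp add: S_def Moebius_function_of_zero Moebius_function_eq_zero)
  have Sb: "S (?M a b) = ?M a b"
    using ab inv[of b] by (simp add: S_def)
  have Mb: "?M a b \<noteq> 0"
    using inv[of b] ab(2) \<open>a \<noteq> b\<close> Moebius_function_of_zero[of 0 "- a"] by auto
  have Mb1: "cmod (?M a b) < 1"
    using Mn a ab by simp
  obtain \<alpha> where \<alpha>: "\<And>z. norm z < 1 \<Longrightarrow> S z = \<alpha> * z"
    using Schwarz_Lemma(3)[OF hol S0 _ Mb1] Mn a T1 Sb Mb Mb1 unfolding S_def by metis
  have "\<alpha> = 1"
    using \<alpha>[OF Mb1] Sb Mb by simp
  \<comment> \<open>The equality case of the Schwarz lemma makes \<open>T\<close> the identity, whose image is too large.\<close>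
  have id: "T z = z" if z: "cmod z < 1" for z
  proof -
    have "?M a (T z) = ?M a z"
      using \<alpha>[OF Mn[OF a(1) z]] \<open>\<alpha> = 1\<close> inv[OF z] by (simp add: S_def)
    then show ?thesis
      using inv[OF z] inv[OF T1[OF z]] by metis
  qed
  have "\<rho> \<ge> 0"
    using T(2)[OF ab(1)] norm_ge_zero[of "T a"] by (simp del: norm_ge_zero)
  then show False
    using id[of "of_real ((1 + \<rho>) / 2)"] T(2)[of "of_real ((1 + \<rho>) / 2)"] T(3)
    by (simp add: norm_divide del: of_real_add of_real_divide)
qed

text \<open>A solution is a fixed point of \<open>z \<mapsto> w / (1 + r p z)\<close>, which maps the disc into \<open>\<bar>z\<bar> \<le> \<bar>w\<bar>\<close>
  because the denominator has real part at least \<open>1\<close>.\<close>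

lemma resolvent_equation:
  assumes p: "p holomorphic_on unit_disc" "\<And>z. z \<in> unit_disc \<Longrightarrow> Re (p z) \<ge> 0"
    and r: "r > 0" and w: "w \<in> unit_disc"
  shows "\<exists>!z. z \<in> unit_disc \<and> z * (1 + of_real r * p z) = w"
proof -
  have Re1: "Re (1 + of_real r * p z) \<ge> 1" if "z \<in> unit_disc" for z
    using p(2)[OF that] r by simp
  then have c1: "cmod (1 + of_real r * p z) \<ge> 1" if "z \<in> unit_disc" for z
    using complex_Re_le_cmod[of "1 + of_real r * p z"] that by fastforce
  define T where "T z = w / (1 + of_real r * p z)" for z
  have nz: "1 + of_real r * p z \<noteq> 0" if "z \<in> unit_disc" for z
    using c1[OF that] by auto
  have hol: "T holomorphic_on unit_disc"
    unfolding T_def by (intro holomorphic_intros p nz)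
  have T_in: "T z \<in> cball 0 (cmod w)" if "z \<in> unit_disc" for z
  proof -
    have "cmod w * 1 \<le> cmod w * cmod (1 + of_real r * p z)"
      by (intro mult_left_mono c1[OF that]) auto
    then show ?thesis
      using c1[OF that] by (simp add: T_def norm_divide divide_le_eq)
  qed
  have T_iff: "T z = z \<longleftrightarrow> z * (1 + of_real r * p z) = w" if "z \<in> unit_disc" for z
    using nz[OF that] by (auto simp: T_def field_simps)
  have "\<exists>z\<in>unit_disc. T z = z"
  proof (cases "w = 0")
    case True
    then show ?thesis
      by (intro bexI[of _ 0]) (auto simp: T_def)
  next
    case False
    have sub: "cball 0 (cmod w) \<subseteq> unit_disc"
      using w by auto
    obtain z where "z \<in> cball 0 (cmod w)" "T z = z"
    proof (rule brouwer_ball)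
      show "cmod w > 0"
        using False by simp
      show "continuous_on (cball 0 (cmod w)) T"
        using holomorphic_on_imp_continuous_on[OF hol] sub continuous_on_subset by blast
      show "T \<in> cball 0 (cmod w) \<rightarrow> cball 0 (cmod w)"
        using T_in sub by blast
    qed
    then show ?thesis
      using sub by blast
  qed
  moreover have "cmod w < 1"
    using w by simp
  ultimately show ?thesis
    using fixed_point_unique[OF hol T_in] T_iff by metis
qed

text \<open>For large \<open>r\<close> the resolvent takes small values: by the Harnack bound the factor
  \<open>1 + r p z\<close> is large unless \<open>z\<close> is near the unit circle, and there it is still at least \<open>1\<close> in modulus.\<close>

lemma resolvent_value_bound:
  assumes p: "p holomorphic_on unit_disc" "\<And>z. z \<in> unit_disc \<Longrightarrow> Re (p z) \<ge> 0"
    and q: "Re (p 0) > 0" and r: "r > 0" and z: "z \<in> unit_disc"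
    and w: "z * (1 + of_real r * p z) \<in> unit_disc"
    and x: "r * Re (p 0) > 2"
  shows "cmod z < 1 / (r * Re (p 0) - 1)"
proof -
  let ?s = "cmod z" and ?x = "r * Re (p 0)"
  have s: "?s < 1"
    using z by simp
  have "r * (Re (p z) * (1 + ?s)) \<ge> r * (Re (p 0) * (1 - ?s))"
    using Harnack_lower_bound[OF p q z] r by (intro mult_left_mono) auto
  then have "1 + ?s + ?x * (1 - ?s) \<le> Re (1 + of_real r * p z) * (1 + ?s)"
    by (simp add: algebra_simps)
  also have "\<dots> \<le> cmod (1 + of_real r * p z) * (1 + ?s)"
    by (intro mult_right_mono complex_Re_le_cmod) auto
  finally have "?s * (1 + ?s + ?x * (1 - ?s)) \<le> ?s * (cmod (1 + of_real r * p z) * (1 + ?s))"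
    by (intro mult_left_mono) auto
  also have "\<dots> = cmod (z * (1 + of_real r * p z)) * (1 + ?s)"
    by (simp add: norm_mult)
  also have "\<dots> < 1 * (1 + ?s)"
    using w by (intro mult_strict_right_mono) (auto simp: add_pos_nonneg)
  \<comment> \<open>The difference of the two sides factorizes, with roots \<open>1\<close> and \<open>1 / (x - 1)\<close>.\<close>
  finally have "0 < (1 - ?s) * (1 - (?x - 1) * ?s)"
    by (simp add: algebra_simps)
  then have "(?x - 1) * ?s < 1"
    using s by (simp add: zero_less_mult_iff)
  then show ?thesis
    using x by (simp add: pos_less_divide_eq mult.commute)
qed

text \<open>With \<open>f z = z p z\<close> the resolvent satisfies \<open>G w (1 + r p (G w)) = w\<close>, so that
  \<open>N = 1 + r p \<circ> G\<close>. Since the values of \<open>G\<close> are small, the Schwarz lemma puts \<open>N w\<close> close to its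
  value \<open>1 + r q\<close> at \<open>w = 0\<close>; the last conclusion is this in Moebius form.\<close>

lemma resolvent_as_quotient:
  assumes f: "generator f" "f 0 = 0" "deriv f 0 = q" and q: "Re q > 0" and r: "r > 0"
    and x: "r * Re q > 2"
    and G: "\<And>w. w \<in> unit_disc \<Longrightarrow> G w = nonlinear_resolvent r f w"
  obtains N where "N holomorphic_on unit_disc" "\<And>w. w \<in> unit_disc \<Longrightarrow> G w = w / N w"
    "\<And>w. w \<in> unit_disc \<Longrightarrow> Re (N w) \<ge> 1"
    "\<And>w. w \<in> unit_disc \<Longrightarrow> \<exists>\<eta>. cmod \<eta> \<le> 1 / (r * Re q - 1) \<and>
       N w * (1 - \<eta>) = (1 + of_real r * q) + (of_real r * cnj q - 1) * \<eta>"
proof -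
  have q': "Re (deriv f 0) > 0"
    using f q by simp
  obtain p where p: "p holomorphic_on unit_disc" "p 0 = q"
    "\<And>z. z \<in> unit_disc \<Longrightarrow> f z = z * p z" "\<And>z. z \<in> unit_disc \<Longrightarrow> Re (p z) \<ge> 0"
    using dissipative_factorization[OF f(1,2) q'] unfolding f(3) by blast
  have q0: "Re (p 0) > 0"
    using p(2) q by simp
  define \<Phi> where "\<Phi> z = z + of_real r * f z" for z
  define U where "U = {z \<in> unit_disc. \<Phi> z \<in> unit_disc}"
  have \<Phi>_eq: "\<Phi> z = z * (1 + of_real r * p z)" if "z \<in> unit_disc" for z
    using p(3)[OF that] by (simp add: \<Phi>_def algebra_simps)
  have unique: "\<exists>!z. z \<in> unit_disc \<and> \<Phi> z = w" if "w \<in> unit_disc" for w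
    using resolvent_equation[OF p(1,4) r that] \<Phi>_eq by metis
  have \<Phi>_hol: "\<Phi> holomorphic_on unit_disc"
    using f(1) unfolding \<Phi>_def generator_def by (intro holomorphic_intros) auto
  have "open (unit_disc \<inter> \<Phi> -` unit_disc)"
    by (rule continuous_open_preimage[OF holomorphic_on_imp_continuous_on[OF \<Phi>_hol] open_ball open_ball])
  then have U: "open U" "U \<subseteq> unit_disc"
    by (auto simp: U_def Int_def vimage_def)
  have inj: "inj_on \<Phi> U"
  proof (rule inj_onI)
    fix a b assume "a \<in> U" "b \<in> U" "\<Phi> a = \<Phi> b"
    then show "a = b"
      using unique[of "\<Phi> a"] unfolding U_def by (metis (mono_tags, lifting) mem_Collect_eq)
  qed
  have img: "\<Phi> ` U = unit_disc"
  proof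
    show "\<Phi> ` U \<subseteq> unit_disc"
      by (auto simp: U_def)
    show "unit_disc \<subseteq> \<Phi> ` U"
    proof
      fix w :: complex assume w: "w \<in> unit_disc"
      then obtain z where z: "z \<in> unit_disc" "\<Phi> z = w"
        using unique by blast
      then show "w \<in> \<Phi> ` U"
        using w by (intro image_eqI[of _ _ z]) (simp_all add: U_def)
    qed
  qed
  obtain h where h: "h holomorphic_on unit_disc"
      "\<And>z. z \<in> U \<Longrightarrow> deriv \<Phi> z * deriv h (\<Phi> z) = 1" "\<And>z. z \<in> U \<Longrightarrow> h (\<Phi> z) = z"
    using holomorphic_has_inverse[OF holomorphic_on_subset[OF \<Phi>_hol U(2)] U(1) inj, unfolded img] by blast
  have h_in: "h w \<in> unit_disc" "\<Phi> (h w) = w" if "w \<in> unit_disc" for w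
  proof -
    have "w \<in> \<Phi> ` U"
      using that img by simp
    then obtain z where "z \<in> U" "w = \<Phi> z"
      by blast
    then show "h w \<in> unit_disc" "\<Phi> (h w) = w"
      using h(3)[of z] U(2) by auto
  qed
  have G_eq: "G w = h w" if w: "w \<in> unit_disc" for w
  proof -
    have "w \<in> \<Phi> ` unit_disc"
      using image_mono[OF U(2), of \<Phi>] w unfolding img by (rule subsetD)
    then have "inv_into unit_disc \<Phi> w \<in> unit_disc" "\<Phi> (inv_into unit_disc \<Phi> w) = w"
      by (rule inv_into_into, rule f_inv_into_f)
    then have "inv_into unit_disc \<Phi> w = h w"
      using unique[OF w] h_in[OF w] by blast
    then show ?thesis
      using G[OF w] by (simp add: nonlinear_resolvent_def \<Phi>_def[abs_def])
  qed
  define N where "N w = 1 + of_real r * p (h w)" for w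
  have N1: "Re (N w) \<ge> 1" if "w \<in> unit_disc" for w
    using p(4)[OF h_in(1)[OF that]] r by (simp add: N_def)
  show ?thesis
  proof (rule that)
    show "N holomorphic_on unit_disc"
      unfolding N_def
      by (intro holomorphic_intros holomorphic_on_compose_gen[unfolded o_def, OF h(1) p(1)])
         (use h_in in auto)
    show "G w = w / N w" if "w \<in> unit_disc" for w
    proof -
      have "h w * N w = w"
        using \<Phi>_eq[OF h_in(1)[OF that]] h_in(2)[OF that] by (simp add: N_def)
      moreover have "N w \<noteq> 0"
        using N1[OF that] by auto
      ultimately show ?thesis
        using G_eq[OF that] by (simp add: field_simps)
    qed
    show "Re (N w) \<ge> 1" if "w \<in> unit_disc" for w
      by (rule N1[OF that])
    fix w assume w: "w \<in> unit_disc"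
    obtain \<eta> where \<eta>: "cmod \<eta> \<le> cmod (h w)" "p (h w) * (1 - \<eta>) = q + cnj q * \<eta>"
      using Schwarz_right_half_plane[OF p(1,4) q0 h_in(1)[OF w]] unfolding p(2) by blast
    have "cmod (h w) < 1 / (r * Re q - 1)"
      using resolvent_value_bound[OF p(1,4) q0 r h_in(1)[OF w]] p(2) x \<Phi>_eq[OF h_in(1)[OF w]] h_in(2)[OF w] w
      by auto
    moreover have "N w * (1 - \<eta>) = (1 - \<eta>) + of_real r * (p (h w) * (1 - \<eta>))"
      by (simp add: N_def algebra_simps)
    then have "N w * (1 - \<eta>) = (1 + of_real r * q) + (of_real r * cnj q - 1) * \<eta>"
      unfolding \<eta>(2) by (simp add: algebra_simps)
    ultimately show "\<exists>\<eta>. cmod \<eta> \<le> 1 / (r * Re q - 1) \<and>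
       N w * (1 - \<eta>) = (1 + of_real r * q) + (of_real r * cnj q - 1) * \<eta>"
      using \<eta>(1) by (intro exI[of _ \<eta>]) auto
  qed
qed

section \<open>Solution in complex time\<close>

text \<open>A substitute for the mean value theorem for complex difference quotients: after projection to
  one real direction, it is the real theorem on the segment from \<open>b\<close> to \<open>a\<close>.\<close>

lemma mean_value_Re:
  assumes S: "convex S" "a \<in> S" "b \<in> S" "a \<noteq> b"
    and F: "\<And>z. z \<in> S \<Longrightarrow> (F has_field_derivative f z) (at z)"
  obtains \<xi> where "\<xi> \<in> S" "Re (c * ((F a - F b) / (a - b))) = Re (c * f \<xi>)"
proof -
  let ?l = "\<lambda>s::real. b + of_real s * (a - b)"
  have l: "?l s \<in> S" if "0 \<le> s" "s \<le> 1" for s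
    using segment_point_in_convex[OF S(1,2,3) that] .
  have "((\<lambda>s. Re (c * (F (?l s) / (a - b)))) has_real_derivative Re (c * f (?l s))) (at s)"
    if s: "0 \<le> s" "s \<le> 1" for s
  proof -
    have "(?l has_vector_derivative (a - b)) (at s)"
      by (auto intro!: derivative_eq_intros)
    moreover have "((\<lambda>z. c * (F z / (a - b))) has_field_derivative c * (f (?l s) / (a - b))) (at (?l s))"
      using S(4) by (auto intro!: derivative_eq_intros F l s)
    ultimately have "((\<lambda>s. c * (F (?l s) / (a - b))) has_vector_derivative
        (a - b) * (c * (f (?l s) / (a - b)))) (at s)"
      using field_vector_diff_chain_at by (fastforce simp: o_def)
    from has_field_derivative_Re[OF this] show ?thesis
      using S(4) by simp
  qed
  from MVT2[OF zero_less_one this] obtain s where "0 < s" "s < 1"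
    "Re (c * (F a / (a - b))) - Re (c * (F b / (a - b))) = Re (c * f (?l s))"
    by auto
  then show ?thesis
    using that[of "?l s"] l[of s] by (simp add: diff_divide_distrib right_diff_distrib)
qed

abbreviation left_half_plane :: "complex set" where
  "left_half_plane \<equiv> {\<zeta>. Re \<zeta> < 0}"

lemma left_half_plane: "open left_half_plane" "convex left_half_plane"
  by (auto simp: open_halfspace_Re_lt convex_halfspace_Re_lt)

text \<open>In the coordinate \<open>\<zeta> = ln z\<close> the equation \<open>u' = - u / N u\<close> becomes \<open>N (exp \<zeta>) \<zeta>' = - 1\<close>.
  A primitive \<open>\<Psi>\<close> of \<open>N (exp \<zeta>)\<close> thus measures time: it decreases at unit speed along orbits.
  As \<open>Re \<Psi>' \<ge> m\<close>, for \<open>m > 0\<close> it is injective on the half-plane, with a Lipschitz inverse.\<close>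

lemma time_function_expands:
  assumes N: "\<And>z. z \<in> unit_disc \<Longrightarrow> m \<le> Re (N z)"
    and \<Psi>: "\<And>\<zeta>. \<zeta> \<in> left_half_plane \<Longrightarrow> (\<Psi> has_field_derivative N (exp \<zeta>)) (at \<zeta>)"
    and ab: "a \<in> left_half_plane" "b \<in> left_half_plane"
  shows "m * cmod (a - b) \<le> cmod (\<Psi> a - \<Psi> b)"
proof (cases "a = b")
  case False
  obtain \<xi> where \<xi>: "\<xi> \<in> left_half_plane"
      "Re (1 * ((\<Psi> a - \<Psi> b) / (a - b))) = Re (1 * N (exp \<xi>))"
    using mean_value_Re[OF left_half_plane(2) ab False \<Psi>] by blast
  have "m \<le> Re ((\<Psi> a - \<Psi> b) / (a - b))"
    using \<xi> N[of "exp \<xi>"] by simp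
  also have "\<dots> \<le> cmod (\<Psi> a - \<Psi> b) / cmod (a - b)"
    using complex_Re_le_cmod[of "(\<Psi> a - \<Psi> b) / (a - b)"] by (simp add: norm_divide)
  finally show ?thesis
    using False by (simp add: field_simps)
qed simp

text \<open>Going from \<open>\<Psi> \<zeta>0\<close> in the direction \<open>- d\<close> means running the equation for complex times
  on the ray through \<open>d\<close>, and the claim is that this can go on for ever. The set of reached times is
  open because the image of \<open>\<Psi>\<close> is, and closed because the inverse of \<open>\<Psi>\<close> is Lipschitz and the
  preimages do not approach the imaginary axis.\<close>

lemma time_function_image_invariant:
  assumes N: "\<And>z. z \<in> unit_disc \<Longrightarrow> m \<le> Re (N z)" and m: "m > 0"
    and \<Psi>: "\<And>\<zeta>. \<zeta> \<in> left_half_plane \<Longrightarrow> (\<Psi> has_field_derivative N (exp \<zeta>)) (at \<zeta>)"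
    and op: "open (\<Psi> ` left_half_plane)"
    and d: "\<And>z. z \<in> unit_disc \<Longrightarrow> Re (cnj d * N z) > 0"
    and \<zeta>0: "\<zeta>0 \<in> left_half_plane" and s: "s \<ge> 0"
  shows "\<Psi> \<zeta>0 - of_real s * d \<in> \<Psi> ` left_half_plane"
proof -
  let ?ray = "\<lambda>s::real. \<Psi> \<zeta>0 - of_real s * d"
  let ?X = "{s \<in> {0..}. ?ray s \<in> \<Psi> ` left_half_plane}"
  have "openin (top_of_set {0..}) ({0..} \<inter> ?ray -` (\<Psi> ` left_half_plane))"
    by (intro continuous_openin_preimage_gen op continuous_intros)
  then have "openin (top_of_set {0..}) ?X"
    by (simp add: Int_def)
  moreover have "closed ?X"
    unfolding closed_sequential_limits
  proof (intro allI impI)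
    fix x and t :: real assume x': "(\<forall>n. x n \<in> ?X) \<and> x \<longlonglongrightarrow> t"
    have "t \<ge> 0"
      using x' by (intro LIMSEQ_le_const[of x t 0]) auto
    with x' have x: "(\<forall>n. x n \<in> ?X) \<and> t \<ge> 0 \<and> x \<longlonglongrightarrow> t"
      by blast
    then have "\<forall>n. \<exists>\<zeta>. \<zeta> \<in> left_half_plane \<and> \<Psi> \<zeta> = ?ray (x n)"
      by (auto simp: image_iff) metis
    then obtain \<zeta> where \<zeta>: "\<And>n. \<zeta> n \<in> left_half_plane" "\<And>n. \<Psi> (\<zeta> n) = ?ray (x n)"
      by metis
    have "Cauchy \<zeta>"
    proof (rule metric_CauchyI)
      fix e :: real assume e: "e > 0"
      have "Cauchy x"
        using x LIMSEQ_imp_Cauchy by blast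
      then obtain M where M: "\<And>i j. i \<ge> M \<Longrightarrow> j \<ge> M \<Longrightarrow> dist (x i) (x j) < m * e / (cmod d + 1)"
        using metric_CauchyD[of x "m * e / (cmod d + 1)"] e m
        by (auto simp: zero_less_mult_iff add_nonneg_pos)
      have "dist (\<zeta> i) (\<zeta> j) < e" if ij: "i \<ge> M" "j \<ge> M" for i j
      proof -
        have "m * cmod (\<zeta> i - \<zeta> j) \<le> cmod (\<Psi> (\<zeta> i) - \<Psi> (\<zeta> j))"
          by (rule time_function_expands[OF N \<Psi> \<zeta>(1) \<zeta>(1)])
        also have "\<Psi> (\<zeta> i) - \<Psi> (\<zeta> j) = of_real (x j - x i) * d"
          by (simp add: \<zeta>(2) algebra_simps)
        also have "cmod \<dots> \<le> dist (x i) (x j) * (cmod d + 1)"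
          by (simp add: norm_mult dist_real_def abs_minus_commute mult_left_mono del: of_real_diff)
        also have "\<dots> < m * e"
          using M[OF ij] by (simp add: pos_less_divide_eq add_nonneg_pos)
        finally show ?thesis
          using m by (simp add: dist_norm)
      qed
      then show "\<exists>M. \<forall>i\<ge>M. \<forall>j\<ge>M. dist (\<zeta> i) (\<zeta> j) < e"
        by blast
    qed
    then obtain \<zeta>' where lim: "\<zeta> \<longlonglongrightarrow> \<zeta>'"
      using Cauchy_convergent convergent_def by blast
    \<comment> \<open>A limit on the imaginary axis would be lost; it is excluded because moving the image in the
      direction \<open>- d\<close> moves the preimage to the left.\<close>
    have "Re (\<zeta> n) \<le> Re \<zeta>0" for n
    proof (cases "\<zeta> n = \<zeta>0")
      case False
      then obtain \<xi> where \<xi>: "\<xi> \<in> left_half_plane"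
          "Re (cnj d * ((\<Psi> \<zeta>0 - \<Psi> (\<zeta> n)) / (\<zeta>0 - \<zeta> n))) = Re (cnj d * N (exp \<xi>))"
        using mean_value_Re[OF left_half_plane(2) \<zeta>0 \<zeta>(1)[of n] _ \<Psi>] by metis
      have "0 < Re (cnj d * ((\<Psi> \<zeta>0 - \<Psi> (\<zeta> n)) / (\<zeta>0 - \<zeta> n)))"
        using \<xi> d[of "exp \<xi>"] by simp
      also have "cnj d * ((\<Psi> \<zeta>0 - \<Psi> (\<zeta> n)) / (\<zeta>0 - \<zeta> n)) = of_real (x n) * (d * cnj d) * inverse (\<zeta>0 - \<zeta> n)"
        by (simp add: \<zeta>(2) divide_inverse)
      also have "\<dots> = of_real (x n * (cmod d)\<^sup>2) * inverse (\<zeta>0 - \<zeta> n)"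
        unfolding of_real_mult complex_norm_square ..
      finally have "0 < x n * (cmod d)\<^sup>2 * (Re (\<zeta>0 - \<zeta> n) / ((Re (\<zeta>0 - \<zeta> n))\<^sup>2 + (Im (\<zeta>0 - \<zeta> n))\<^sup>2))"
        by simp
      moreover have "0 \<le> x n * (cmod d)\<^sup>2"
        using x by simp
      ultimately have "0 < Re (\<zeta>0 - \<zeta> n)"
        by (smt (verit) divide_nonpos_nonneg mult_nonneg_nonpos sum_power2_ge_zero)
      then show ?thesis
        by simp
    qed simp
    then have "Re \<zeta>' \<le> Re \<zeta>0"
      by (intro LIMSEQ_le_const2[OF tendsto_Re[OF lim]]) auto
    then have \<zeta>': "\<zeta>' \<in> left_half_plane"
      using \<zeta>0 by simp
    have "(\<lambda>n. \<Psi> (\<zeta> n)) \<longlonglongrightarrow> \<Psi> \<zeta>'"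
      using isCont_tendsto_compose[OF DERIV_isCont[OF \<Psi>[OF \<zeta>']] lim] .
    moreover have "(\<lambda>n. \<Psi> (\<zeta> n)) \<longlonglongrightarrow> ?ray t"
      unfolding \<zeta>(2) using x by (intro tendsto_intros) auto
    ultimately have "\<Psi> \<zeta>' = ?ray t"
      by (rule LIMSEQ_unique)
    then show "t \<in> ?X"
      using \<zeta>' x by (auto simp: image_iff intro!: exI[of _ \<zeta>'])
  qed
  then have "closedin (top_of_set {0..}) ?X"
    by (intro closed_subset) auto
  moreover have "0 \<in> ?X"
    using \<zeta>0 by auto
  ultimately have "?X = {0..}"
    using connected_clopen[of "{0::real..}"] convex_connected[OF convex_real_interval(1)[of 0]]
    by (metis (no_types, lifting) empty_iff)
  then show ?thesis
    using s by blast
qed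

text \<open>The solution is \<open>exp (\<Psi>\<inverse> (\<Psi> (ln z) - t))\<close>. It is holomorphic in \<open>t\<close> on the reflected and shifted
  image of \<open>\<Psi>\<close>, which is connected and contains every ray that the invariance permits; the direction
  \<open>d = 1\<close> is always permitted and gives the real times.\<close>

lemma holomorphic_flow:
  assumes N: "N holomorphic_on unit_disc" "\<And>z. z \<in> unit_disc \<Longrightarrow> m \<le> Re (N z)" and m: "m > 0"
    and g: "\<And>z. z \<in> unit_disc \<Longrightarrow> g z = z / N z"
    and z: "z \<in> unit_disc"
  obtains \<Omega> F where "open \<Omega>" "connected \<Omega>" "F holomorphic_on \<Omega>"
    "cauchy_solution g z (\<lambda>t. F (of_real t))"
    "\<And>d s. s \<ge> 0 \<Longrightarrow> (\<And>w. w \<in> unit_disc \<Longrightarrow> Re (cnj d * N w) > 0) \<Longrightarrow> of_real s * d \<in> \<Omega>"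
proof (cases "z = 0")
  case True
  then show ?thesis
    using that[of UNIV "\<lambda>_. 0"] g[of 0] by (auto simp: cauchy_solution_def)
next
  case False
  let ?H = left_half_plane
  have hol: "(\<lambda>\<zeta>. N (exp \<zeta>)) holomorphic_on ?H"
    using holomorphic_on_compose_gen[OF holomorphic_on_exp N(1), of ?H]
    by (simp add: o_def image_subset_iff)
  obtain \<Psi> where "\<And>\<zeta>. \<zeta> \<in> ?H \<Longrightarrow> (\<Psi> has_field_derivative N (exp \<zeta>)) (at \<zeta> within ?H)"
    using holomorphic_convex_primitive'[OF left_half_plane(2,1) hol] by blast
  then have \<Psi>: "(\<Psi> has_field_derivative N (exp \<zeta>)) (at \<zeta>)" if "\<zeta> \<in> ?H" for \<zeta>
    using that at_within_open[OF that left_half_plane(1)] by metis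
  have \<Psi>_hol: "\<Psi> holomorphic_on ?H"
    unfolding holomorphic_on_open[OF left_half_plane(1)] using \<Psi> by blast
  have inj: "inj_on \<Psi> ?H"
  proof (rule inj_onI)
    fix a b assume ab: "a \<in> ?H" "b \<in> ?H" "\<Psi> a = \<Psi> b"
    have "m * cmod (a - b) \<le> cmod (\<Psi> a - \<Psi> b)"
      by (rule time_function_expands[OF N(2) \<Psi> ab(1,2)])
    then show "a = b"
      using ab(3) m by (simp add: mult_le_0_iff)
  qed
  have op: "open (\<Psi> ` ?H)"
    by (rule open_mapping_thm3[OF \<Psi>_hol left_half_plane(1) inj])
  obtain \<Phi> where \<Phi>: "\<Phi> holomorphic_on \<Psi> ` ?H" "\<And>\<zeta>. \<zeta> \<in> ?H \<Longrightarrow> deriv \<Psi> \<zeta> * deriv \<Phi> (\<Psi> \<zeta>) = 1"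
      "\<And>\<zeta>. \<zeta> \<in> ?H \<Longrightarrow> \<Phi> (\<Psi> \<zeta>) = \<zeta>"
    using holomorphic_has_inverse[OF \<Psi>_hol left_half_plane(1) inj] by blast
  define \<zeta>0 where "\<zeta>0 = Ln z"
  have \<zeta>0: "\<zeta>0 \<in> ?H" "exp \<zeta>0 = z"
    using z False by (auto simp: \<zeta>0_def)
  define \<Omega> where "\<Omega> = (\<lambda>w. \<Psi> \<zeta>0 - w) ` \<Psi> ` ?H"
  have \<Omega>_iff: "t \<in> \<Omega> \<longleftrightarrow> \<Psi> \<zeta>0 - t \<in> \<Psi> ` ?H" for t
  proof
    show "t \<in> \<Omega>" if "\<Psi> \<zeta>0 - t \<in> \<Psi> ` ?H"
      unfolding \<Omega>_def by (rule image_eqI[OF _ that]) simp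
  qed (auto simp: \<Omega>_def)
  define F where "F t = exp (\<Phi> (\<Psi> \<zeta>0 - t))" for t
  have dF: "F t \<in> unit_disc \<and> (F has_field_derivative - g (F t)) (at t)" if "t \<in> \<Omega>" for t
  proof -
    obtain \<zeta> where \<zeta>: "\<zeta> \<in> ?H" "\<Psi> \<zeta>0 - t = \<Psi> \<zeta>"
      using \<open>t \<in> \<Omega>\<close> \<Omega>_iff by blast
    have Ft: "F t = exp \<zeta>" "F t \<in> unit_disc"
      using \<zeta> \<Phi>(3) by (auto simp: F_def)
    have "(\<Phi> has_field_derivative deriv \<Phi> (\<Psi> \<zeta>)) (at (\<Psi> \<zeta>0 - t))"
      using holomorphic_derivI[OF \<Phi>(1) op, of "\<Psi> \<zeta>0 - t"] \<zeta> by auto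
    then have "(F has_field_derivative exp (\<Phi> (\<Psi> \<zeta>0 - t)) * (deriv \<Phi> (\<Psi> \<zeta>) * (0 - 1))) (at t)"
      unfolding F_def by (intro derivative_intros DERIV_chain2[of \<Phi>])
    moreover have "N (exp \<zeta>) * deriv \<Phi> (\<Psi> \<zeta>) = 1"
      using \<Phi>(2)[OF \<zeta>(1)] DERIV_imp_deriv[OF \<Psi>[OF \<zeta>(1)]] by simp
    then have "deriv \<Phi> (\<Psi> \<zeta>) = 1 / N (exp \<zeta>)"
      by (metis mult_zero_left nonzero_eq_divide_eq mult.commute zero_neq_one)
    ultimately show ?thesis
      using Ft g[of "F t"] by (simp add: F_def)
  qed
  have ray: "of_real s * d \<in> \<Omega>" if "s \<ge> 0" "\<And>w. w \<in> unit_disc \<Longrightarrow> Re (cnj d * N w) > 0" for d s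
    unfolding \<Omega>_iff by (rule time_function_image_invariant[OF N(2) m \<Psi> op that(2) \<zeta>0(1) that(1)])
  have real: "of_real t \<in> \<Omega>" if "t \<ge> 0" for t
    using ray[OF that, of 1] N(2) m by (simp add: order.strict_trans2)
  show ?thesis
  proof (rule that[of \<Omega> F])
    show "open \<Omega>"
    proof -
      have "\<Omega> = (\<lambda>t. \<Psi> \<zeta>0 - t) -` (\<Psi> ` ?H)"
        using \<Omega>_iff by auto
      then show ?thesis
        by (auto intro!: open_vimage op continuous_intros)
    qed
    show "connected \<Omega>"
      unfolding \<Omega>_def
      by (intro connected_continuous_image continuous_intros convex_connected left_half_plane
          holomorphic_on_imp_continuous_on[OF \<Psi>_hol])
    show "F holomorphic_on \<Omega>"
      using dF field_differentiable_def field_differentiable_at_within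
      unfolding holomorphic_on_def by blast
    have "((\<lambda>t. F (of_real t)) has_vector_derivative - g (F (of_real t))) (at t within {0..})"
      if "t \<ge> 0" for t
      using dF[OF real[OF that]] by (intro has_vector_derivative_real_field) blast
    moreover have "F 0 = z"
      using \<Phi>(3)[OF \<zeta>0(1)] \<zeta>0(2) by (simp add: F_def)
    ultimately show "cauchy_solution g z (\<lambda>t. F (of_real t))"
      unfolding cauchy_solution_def using dF real by simp
  qed (use ray in auto)
qed

section \<open>Estimates for the factor N\<close>

lemma norm_exp_minus_one_le: "norm (exp z - 1) \<le> exp (norm z) - 1" for z :: complex
proof -
  let ?a = "\<lambda>n. z ^ Suc n /\<^sub>R fact (Suc n)" and ?b = "\<lambda>n. norm z ^ Suc n /\<^sub>R fact (Suc n)"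
  have nb: "norm (?a n) = ?b n" for n
    by (simp add: norm_power norm_mult)
  have sb: "summable ?b"
    using summable_ignore_initial_segment[OF summable_exp_generic[of "norm z"], of 1] by simp
  have "norm (exp z - 1) = norm (\<Sum>n. ?a n)"
    using exp_first_term[of z] by simp
  also have "\<dots> \<le> (\<Sum>n. norm (?a n))"
    unfolding nb[symmetric] by (intro summable_norm) (use sb nb in simp)
  also have "\<dots> = exp (norm z) - 1"
    unfolding nb using exp_first_term[of "norm z"] by simp
  finally show ?thesis .
qed

text \<open>The inverse \<open>exp (- z)\<close> lies in the disc of radius \<open>1\<close> about \<open>1\<close>,
  because \<open>exp (ln 2) - 1 = 1\<close>, and inversion maps this disc to
  the half-plane \<open>Re \<ge> 1 / 2\<close>.\<close>

lemma Re_exp_ge_half: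
  assumes "cmod z \<le> ln 2"
  shows "Re (exp z) \<ge> 1 / 2"
proof -
  have "cmod (exp (- z) - 1) \<le> exp (cmod z) - 1"
    using norm_exp_minus_one_le[of "- z"] by simp
  also have "\<dots> \<le> 1"
    using assms exp_le_cancel_iff[of "cmod z" "ln 2"] by simp
  finally have "cmod (exp z) * cmod (exp (- z) - 1) \<le> cmod (exp z)"
    by (simp add: mult_left_le)
  moreover have "exp z * (exp (- z) - 1) = 1 - exp z"
    by (simp add: right_diff_distrib exp_minus)
  ultimately have "cmod (1 - exp z) \<le> cmod (exp z)"
    by (metis norm_mult)
  then have "(cmod (1 - exp z))\<^sup>2 \<le> (cmod (exp z))\<^sup>2"
    by (intro power_mono) auto
  then show ?thesis
    unfolding cmod_power2 by (simp add: power2_eq_square algebra_simps del: Re_exp Im_exp)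
qed

lemma norm_Ln_1_plus_le:
  assumes "cmod z \<le> s" "s < 1"
  shows "cmod (Ln (1 + z)) \<le> s / (1 - s)"
proof -
  have s: "0 \<le> s"
    using assms(1) norm_ge_zero[of z] by linarith
  have "cmod (Ln (1 + z) - Ln (1 + 0)) \<le> (1 / (1 - s)) * cmod (z - 0)"
  proof (rule field_differentiable_bound[of "cball 0 s"])
    fix w :: complex assume w: "w \<in> cball 0 s"
    have "Re (- w) \<le> cmod w"
      using complex_Re_le_cmod[of "- w"] by simp
    then have Re: "Re (1 + w) \<ge> 1 - s"
      using w by simp
    then have "1 + w \<notin> \<real>\<^sub>\<le>\<^sub>0"
      using assms(2) by (auto simp: complex_nonpos_Reals_iff)
    then have "((\<lambda>w. Ln (1 + w)) has_field_derivative inverse (1 + w) * (0 + 1)) (at w)"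
      by (intro DERIV_chain2[OF has_field_derivative_Ln] derivative_intros)
    then show "((\<lambda>w. Ln (1 + w)) has_field_derivative inverse (1 + w)) (at w within cball 0 s)"
      by (simp add: has_field_derivative_at_within)
    have "1 - s \<le> cmod (1 + w)"
      using Re complex_Re_le_cmod[of "1 + w"] by linarith
    then have "inverse (cmod (1 + w)) \<le> inverse (1 - s)"
      using assms(2) by (intro le_imp_inverse_le) auto
    then show "cmod (inverse (1 + w)) \<le> 1 / (1 - s)"
      by (simp add: norm_inverse divide_inverse)
  qed (use assms s in auto)
  also have "\<dots> \<le> (1 / (1 - s)) * s"
    using assms by (intro mult_left_mono) auto
  finally show ?thesis
    by simp
qed

text \<open>A logarithm of \<open>N / a\<close> is the difference of the logarithms of two numbers within \<open>s\<close> of \<open>1\<close>.\<close>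

lemma half_plane_quotient_exp:
  assumes \<eta>: "cmod \<eta> \<le> s" "s < 1" and b: "cmod b \<le> cmod a" and a: "a \<noteq> 0"
    and N: "N * (1 - \<eta>) = a + b * \<eta>"
  obtains \<Lambda> where "N = a * exp \<Lambda>" "cmod \<Lambda> \<le> 2 * s / (1 - s)"
proof -
  define c where "c = b / a * \<eta>"
  have "cmod (b / a) * cmod \<eta> \<le> 1 * cmod \<eta>"
    using a b by (intro mult_right_mono) (auto simp: norm_divide)
  then have c: "cmod c \<le> s"
    using \<eta> unfolding c_def norm_mult by linarith
  have nz: "1 + w \<noteq> 0" if "cmod w \<le> s" for w
  proof
    assume "1 + w = 0"
    then have "w = - 1"
      by (simp add: eq_neg_iff_add_eq_0 add.commute)
    then show False
      using that \<eta>(2) by simp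
  qed
  have "N = a * exp (Ln (1 + c) - Ln (1 + - \<eta>))"
  proof -
    have "a * (1 + c) = N * (1 - \<eta>)"
      unfolding N using a by (simp add: c_def distrib_left)
    then show ?thesis
      using nz[OF c] nz[of "- \<eta>"] \<eta>(1) by (simp add: exp_diff)
  qed
  moreover have "cmod (Ln (1 + c) - Ln (1 + - \<eta>)) \<le> s / (1 - s) + s / (1 - s)"
    using norm_Ln_1_plus_le[OF c \<eta>(2)] norm_Ln_1_plus_le[of "- \<eta>" s] \<eta>
    by (intro order_trans[OF norm_triangle_ineq4] add_mono) auto
  then have "cmod (Ln (1 + c) - Ln (1 + - \<eta>)) \<le> 2 * s / (1 - s)"
    by simp
  ultimately show ?thesis
    by (rule that)
qed

text \<open>With \<open>\<gamma> = (1 - A x) / (1 + A x)\<close> the last bound reads \<open>2 / (x - 2) \<le> ln 2 * (1 - \<gamma>)\<close>: its left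
  side bounds the modulus of a logarithm of \<open>N / (1 + r q)\<close>, and its right side is the modulus that the
  two lower bounds on real parts below can afford.\<close>

lemma A_fun_bounds:
  assumes x: "x \<ge> 6"
  shows "0 < A_fun x" "A_fun x < 1"
    and "2 / (x - 2) \<le> ln 2 * (2 * A_fun x / (1 + A_fun x))"
proof -
  let ?n = "6 * x * (1 + x)" and ?d = "(1 + x) ^ 3 - 3 * (5 * x - 1)"
  have n: "?n > 0"
    using x by simp
  have "?d - ?n = x * (x - 6) * (x + 3) + 4"
    by (simp add: power3_eq_cube algebra_simps)
  also have "\<dots> > 0"
    using x by (intro add_nonneg_pos mult_nonneg_nonneg) auto
  finally have nd: "?n < ?d"
    by simp
  then have d: "?d > 0"
    using n by linarith
  show "0 < A_fun x" "A_fun x < 1"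
    using n d nd by (auto simp: A_fun_def)
  have ratio: "A_fun x / (1 + A_fun x) = ?n / (?d + ?n)"
  proof -
    have "a / b / (1 + a / b) = a / (b + a)" if "a > 0" "b > 0" for a b :: real
      using that by (simp add: field_simps)
    then show ?thesis
      unfolding A_fun_def using n d by blast
  qed
  \<comment> \<open>It is enough to have \<open>2 / 3\<close> in place of \<open>ln 2\<close>, which leaves a cubic inequality; it is
    evident once the factor \<open>x - 6\<close> is split off.\<close>
  have "2 / 3 * ?n * (x - 2) - (?d + ?n) = (x - 6) * (3 * x\<^sup>2 + 5 * x + 28) + 164"
    by (simp add: power3_eq_cube power2_eq_square algebra_simps)
  also have "\<dots> \<ge> 0"
    using x by (intro add_nonneg_nonneg mult_nonneg_nonneg) auto
  finally have "?d + ?n \<le> 2 / 3 * ?n * (x - 2)"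
    by (simp only: diff_ge_0_iff_ge)
  then have "1 / (x - 2) \<le> 2 / 3 * (?n / (?d + ?n))"
  proof -
    have *: "1 / y \<le> 2 / 3 * (a / b)" if "b \<le> 2 / 3 * a * y" "y > 0" "b > 0" for a b y :: real
      using that by (simp add: field_simps)
    show "?d + ?n \<le> 2 / 3 * ?n * (x - 2) \<Longrightarrow> ?thesis"
      by (rule * [OF _ _ add_pos_pos[OF d n]]) (use x in auto)
  qed
  also have "\<dots> \<le> ln 2 * (?n / (?d + ?n))"
    using ln2_ge_two_thirds d n by (intro mult_right_mono) auto
  finally have "1 / (x - 2) \<le> ln 2 * (A_fun x / (1 + A_fun x))"
    unfolding ratio .
  then have "2 * (1 / (x - 2)) \<le> 2 * (ln 2 * (A_fun x / (1 + A_fun x)))"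
    by (rule mult_left_mono) simp
  then show "2 / (x - 2) \<le> ln 2 * (2 * A_fun x / (1 + A_fun x))"
    by (simp only: times_divide_eq_right mult.left_commute mult_1_right)
qed

text \<open>Concavity of \<open>ln cos\<close>.\<close>

lemma cos_weighted_geometric_mean_le:
  fixes u v g :: real
  assumes u: "\<bar>u\<bar> < pi / 2" and v: "\<bar>v\<bar> < pi / 2" and g: "0 \<le> g" "g \<le> 1"
  shows "cos u powr (1 - g) * cos v powr g \<le> cos ((1 - g) * u + g * v)"
proof -
  let ?I = "{- (pi / 2)<..<pi / 2}"
  have cos_pos: "cos x > 0" if "x \<in> ?I" for x
    using that by (intro cos_gt_zero_pi) auto
  have "convex_on ?I (\<lambda>x. - ln (cos x))"
  proof (rule convex_on_realI[where f' = tan])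
    show "((\<lambda>x. - ln (cos x)) has_real_derivative tan x) (at x)" if "x \<in> ?I" for x
      using cos_pos[OF that] by (auto intro!: derivative_eq_intros simp: tan_def)
    show "tan x \<le> tan y" if "x \<in> ?I" "y \<in> ?I" "x \<le> y" for x y
      using that by (intro tan_mono_le) auto
  qed auto
  have I: "u \<in> ?I" "v \<in> ?I"
  proof -
    have "- (pi / 2) < u" "u < pi / 2" "- (pi / 2) < v" "v < pi / 2"
      using u v by linarith+
    then show "u \<in> ?I" "v \<in> ?I"
      by simp_all
  qed
  from convex_onD[OF \<open>convex_on ?I _\<close> g I]
  have le: "(1 - g) * ln (cos u) + g * ln (cos v) \<le> ln (cos ((1 - g) * u + g * v))"
    by simp
  have "(1 - g) *\<^sub>R u + g *\<^sub>R v \<in> ?I"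
    by (rule convexD_alt) (use I g in auto)
  then have pos: "cos u > 0" "cos v > 0" "cos ((1 - g) * u + g * v) > 0"
    using I by (auto intro!: cos_pos)
  have "cos u powr (1 - g) * cos v powr g = exp ((1 - g) * ln (cos u) + g * ln (cos v))"
    using pos by (simp add: powr_def exp_add)
  also have "\<dots> \<le> exp (ln (cos ((1 - g) * u + g * v)))"
    using le by simp
  finally show ?thesis
    using pos by simp
qed

text \<open>Multiplied by \<open>\<bar>a\<bar>\<close>, the real part is \<open>exp ((1 - \<gamma>) Re L) cos ((1 - \<gamma>) Im L - Arg a)\<close> with
  \<open>\<bar>L\<bar> \<le> ln 2\<close>. Log-concavity of the cosine separates this into \<open>(Re (exp L))\<close> to the power \<open>1 - \<gamma>\<close>, which
  costs the factor \<open>2\<close> to the power \<open>- (1 - \<gamma>)\<close>, and \<open>cos (Arg a / \<gamma>)\<close> to the power \<open>\<gamma>\<close>, which is the remaining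
  part of \<open>\<kappa>\<close>.\<close>

lemma Re_inverse_lower_bound:
  assumes a: "a \<noteq> 0" and \<gamma>: "0 < \<gamma>" "\<gamma> < 1" and Arg: "\<bar>Arg a\<bar> < pi * \<gamma> / 2"
    and \<Lambda>: "cmod \<Lambda> \<le> ln 2 * (1 - \<gamma>)"
    and \<kappa>: "\<kappa> = Re (a powr of_real (1 / \<gamma>)) powr \<gamma> / (2 powr (1 - \<gamma>) * (cmod a)\<^sup>2)"
  shows "\<kappa> > 0" "Re (1 / (a * exp \<Lambda>)) \<ge> \<kappa>"
proof -
  \<comment> \<open>\<open>1 / N = exp ((1 - \<gamma>) L) / a\<close>, where \<open>exp L\<close> ranges over a subset of \<open>Re \<ge> 1 / 2\<close>.\<close>
  define L where "L = - \<Lambda> / of_real (1 - \<gamma>)"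
  define v where "v = - Arg a / \<gamma>"
  have \<Lambda>_eq: "- \<Lambda> = of_real (1 - \<gamma>) * L"
    using \<gamma> by (simp add: L_def del: of_real_diff)
  have L: "cmod L \<le> ln 2"
    using \<Lambda> \<gamma> by (simp add: L_def norm_divide pos_divide_le_eq del: of_real_diff)
  then have ImL: "\<bar>Im L\<bar> < pi / 2"
    using abs_Im_le_cmod[of L] ln2_le_25_over_36 pi_gt3 by linarith
  have v: "\<bar>v\<bar> < pi / 2"
    using Arg \<gamma> by (simp add: v_def abs_divide field_simps)
  then have cos_v: "cos v > 0"
    by (intro cos_gt_zero_pi) linarith+
  have a_polar: "a = exp (of_real (ln (cmod a)) + \<i> * of_real (Arg a))"
    using a by (simp add: exp_add Arg_eq exp_of_real)
  have "Ln a = of_real (ln (cmod a)) + \<i> * of_real (Arg a)"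
    using a by (simp add: complex_eq_iff Arg_eq_Im_Ln)
  then have "a powr of_real (1 / \<gamma>) = exp (of_real (1 / \<gamma>) * (of_real (ln (cmod a)) + \<i> * of_real (Arg a)))"
    using a by (simp only: powr_def if_False)
  then have "Re (a powr of_real (1 / \<gamma>)) = exp (ln (cmod a) / \<gamma>) * cos v"
    using \<gamma> by (simp add: Re_exp v_def)
  then have "Re (a powr of_real (1 / \<gamma>)) powr \<gamma> = cmod a * cos v powr \<gamma>"
    using \<gamma> cos_v a by (simp add: powr_mult powr_def[of "exp _"])
  then have \<kappa>_eq: "\<kappa> = (1 / 2) powr (1 - \<gamma>) * cos v powr \<gamma> / cmod a"
    unfolding \<kappa> using a by (simp add: power2_eq_square powr_divide)
  then show "\<kappa> > 0"
    using cos_v a by simp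
  have "exp (Re L) * cos (Im L) \<ge> 1 / 2"
    using Re_exp_ge_half[OF L] by (simp add: Re_exp)
  then have "(1 / 2) powr (1 - \<gamma>) \<le> (exp (Re L) * cos (Im L)) powr (1 - \<gamma>)"
    using \<gamma> by (intro powr_mono2) auto
  also have "\<dots> = exp ((1 - \<gamma>) * Re L) * cos (Im L) powr (1 - \<gamma>)"
    using cos_gt_zero_pi[of "Im L"] ImL by (simp add: powr_mult powr_def[of "exp _"] abs_less_iff)
  finally have "(1 / 2) powr (1 - \<gamma>) * cos v powr \<gamma> \<le>
      exp ((1 - \<gamma>) * Re L) * cos (Im L) powr (1 - \<gamma>) * cos v powr \<gamma>"
    by (intro mult_right_mono) auto
  also have "\<dots> \<le> exp ((1 - \<gamma>) * Re L) * cos ((1 - \<gamma>) * Im L + \<gamma> * v)"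
    using cos_weighted_geometric_mean_le[OF ImL v, of \<gamma>] \<gamma>
    by (simp add: mult.assoc)
  also have "\<dots> = Re (exp (of_real (1 - \<gamma>) * L - \<i> * of_real (Arg a)))"
    using \<gamma> by (simp add: Re_exp v_def)
  finally have "\<kappa> \<le> Re (exp (of_real (1 - \<gamma>) * L - \<i> * of_real (Arg a))) / cmod a"
    unfolding \<kappa>_eq by (rule divide_right_mono) simp
  also have "\<dots> = Re (exp (- \<Lambda> - \<i> * of_real (Arg a)) / of_real (cmod a))"
    unfolding \<Lambda>_eq by simp
  also have "exp (- \<Lambda> - \<i> * of_real (Arg a)) / of_real (cmod a) = 1 / (a * exp \<Lambda>)"
    using a by (subst (3) a_polar) (simp add: exp_add exp_diff exp_minus exp_of_real field_simps)
  finally show "\<kappa> \<le> Re (1 / (a * exp \<Lambda>))" .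
qed

text \<open>The argument of the product differs from \<open>Arg a - \<theta>\<close> by at most
  \<open>ln 2 * (1 - \<gamma>) \<le> pi / 2 - pi * \<gamma> / 2\<close>, so its modulus stays below \<open>pi / 2\<close>.\<close>

lemma Re_sector_pos:
  assumes a: "a \<noteq> 0" and \<gamma>: "0 < \<gamma>" "\<gamma> < 1" and \<theta>: "\<bar>\<theta> - Arg a\<bar> < pi * \<gamma> / 2"
    and \<Lambda>: "cmod \<Lambda> \<le> ln 2 * (1 - \<gamma>)"
  shows "Re (cnj (cis \<theta>) * (a * exp \<Lambda>)) > 0"
proof -
  have "ln 2 * (1 - \<gamma>) \<le> pi / 2 * (1 - \<gamma>)"
    using \<gamma> ln2_le_25_over_36 pi_gt3 by (intro mult_right_mono) auto
  then have "\<bar>Im \<Lambda>\<bar> \<le> pi / 2 - pi * \<gamma> / 2"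
    using \<Lambda> abs_Im_le_cmod[of \<Lambda>] by (simp add: algebra_simps)
  then have "\<bar>Arg a - \<theta> + Im \<Lambda>\<bar> < pi / 2"
    using \<theta> by linarith
  then have "cos (Arg a - \<theta> + Im \<Lambda>) > 0"
    by (intro cos_gt_zero_pi) linarith+
  moreover have "cnj (cis \<theta>) * (a * exp \<Lambda>) =
      of_real (cmod a * exp (Re \<Lambda>)) * cis (Arg a - \<theta> + Im \<Lambda>)"
  proof -
    have "a = of_real (cmod a) * cis (Arg a)"
      using rcis_cmod_Arg[of a] by (simp add: rcis_def)
    moreover have "cis (Arg a - \<theta> + Im \<Lambda>) = cis (Arg a) * cis (- \<theta>) * cis (Im \<Lambda>)"
      by (simp add: cis_mult)
    ultimately show ?thesis
      by (simp add: exp_eq_polar cis_cnj mult_ac)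
  qed
  ultimately show ?thesis
    using a by simp
qed

section \<open>The semigroup generated by a resolvent\<close>

text \<open>The derivative of \<open>\<bar>v\<bar>\<^sup>2\<close> is \<open>- 2 \<bar>v\<bar>\<^sup>2 Re (1 / N v) \<le> - 2 k \<bar>v\<bar>\<^sup>2\<close>.\<close>

lemma cauchy_solution_decay:
  assumes g: "\<And>w. w \<in> unit_disc \<Longrightarrow> g w = w / N w"
    and k: "\<And>w. w \<in> unit_disc \<Longrightarrow> Re (1 / N w) \<ge> k"
    and v: "cauchy_solution g z v" and t: "t \<ge> 0"
  shows "cmod (v t) \<le> cmod z * exp (- k * t)"
proof -
  have v': "v s \<in> unit_disc" "(v has_vector_derivative - g (v s)) (at s within {0..})" if "s \<ge> 0" for s
    using v that by (auto simp: cauchy_solution_def)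
  let ?\<phi> = "\<lambda>s. (v s \<bullet> v s) * exp (2 * k * s)"
  have "?\<phi> t \<le> ?\<phi> 0"
  proof (rule DERIV_nonpos_imp_decreasing_open[OF t])
    show "continuous_on {0..t} ?\<phi>"
      using cauchy_solution_continuous[OF v, of "{0..t}"] by (auto intro!: continuous_intros)
    fix s assume s: "0 < s" "s < t"
    then have "at s within {0..} = at s"
      by (intro at_within_interior) (simp add: interior_real_atLeast)
    then have "(v has_derivative (\<lambda>h. h *\<^sub>R (- g (v s)))) (at s)"
      using v'(2)[of s] s by (simp add: has_vector_derivative_def)
    then have "((\<lambda>s. v s \<bullet> v s) has_derivative
        (\<lambda>h. v s \<bullet> (h *\<^sub>R (- g (v s))) + (h *\<^sub>R (- g (v s))) \<bullet> v s)) (at s)"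
      by (intro has_derivative_inner)
    then have "((\<lambda>s. v s \<bullet> v s) has_real_derivative - 2 * (v s \<bullet> g (v s))) (at s)"
      unfolding has_field_derivative_def
      by (rule has_derivative_eq_rhs) (auto simp: inner_commute algebra_simps)
    then have D: "(?\<phi> has_real_derivative
        (- 2 * (v s \<bullet> g (v s))) * exp (2 * k * s) + (v s \<bullet> v s) * (exp (2 * k * s) * (2 * k))) (at s)"
      by (auto intro!: derivative_eq_intros)
    have "v s \<bullet> g (v s) = (v s \<bullet> v s) * Re (1 / N (v s))"
    proof -
      have "v s \<bullet> (v s * c) = (v s \<bullet> v s) * Re c" for c
        by (simp add: inner_complex_def algebra_simps)
      from this[of "1 / N (v s)"] show ?thesis
        using g v'(1)[of s] s by simp
    qed
    also have "\<dots> \<ge> (v s \<bullet> v s) * k"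
      using k v'(1)[of s] s by (intro mult_left_mono) auto
    finally have "2 * exp (2 * k * s) * ((v s \<bullet> v s) * k - v s \<bullet> g (v s)) \<le> 0"
      by (intro mult_nonneg_nonpos) auto
    then have "(- 2 * (v s \<bullet> g (v s))) * exp (2 * k * s) + (v s \<bullet> v s) * (exp (2 * k * s) * (2 * k)) \<le> 0"
      by (simp add: algebra_simps)
    with D show "\<exists>y. (?\<phi> has_real_derivative y) (at s) \<and> y \<le> 0"
      by blast
  qed
  moreover have "v 0 = z"
    using v by (simp add: cauchy_solution_def)
  moreover have "exp (2 * k * t) = (exp (k * t))\<^sup>2"
    by (simp add: exp_double[symmetric] mult.assoc)
  ultimately have "(cmod (v t) * exp (k * t))\<^sup>2 \<le> (cmod z)\<^sup>2"
    by (simp add: power2_norm_eq_inner power_mult_distrib)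
  then have "cmod (v t) * exp (k * t) \<le> cmod z"
    by (rule power2_le_imp_le) simp
  then show ?thesis
    by (simp add: exp_minus field_simps)
qed

lemma resolvent_family_quotient:
  assumes q: "Re q > 0" and r: "r \<ge> 6 / Re q" and G: "G \<in> resolvent_family r q"
  obtains N where "N holomorphic_on unit_disc" "\<And>w. w \<in> unit_disc \<Longrightarrow> G w = w / N w"
    "\<And>w. w \<in> unit_disc \<Longrightarrow> Re (N w) \<ge> 1"
    "\<And>w. w \<in> unit_disc \<Longrightarrow> \<exists>\<Lambda>. N w = (1 + of_real r * q) * exp \<Lambda> \<and> cmod \<Lambda> \<le> ln 2 * (1 - gamma_r r q)"
proof -
  let ?x = "r * Re q" and ?a = "1 + of_real r * q"
  have x: "?x \<ge> 6"
    using q r by (simp add: divide_le_eq)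
  have r0: "r > 0"
    using q r by (meson divide_pos_pos less_le_trans zero_less_numeral)
  obtain f where f: "generator f" "f 0 = 0" "deriv f 0 = q"
      and Gf: "\<And>w. w \<in> unit_disc \<Longrightarrow> G w = nonlinear_resolvent r f w"
    using G unfolding resolvent_family_def by blast
  have x2: "?x > 2"
    using x by simp
  obtain N where N: "N holomorphic_on unit_disc" "\<And>w. w \<in> unit_disc \<Longrightarrow> G w = w / N w"
    "\<And>w. w \<in> unit_disc \<Longrightarrow> Re (N w) \<ge> 1"
    "\<And>w. w \<in> unit_disc \<Longrightarrow> \<exists>\<eta>. cmod \<eta> \<le> 1 / (?x - 1) \<and>
       N w * (1 - \<eta>) = ?a + (of_real r * cnj q - 1) * \<eta>"
    using resolvent_as_quotient[OF f q r0 x2 Gf] by blast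
  have "(cmod (of_real r * cnj q - 1))\<^sup>2 \<le> (cmod ?a)\<^sup>2"
    unfolding cmod_power2 using r0 q by (simp add: power2_eq_square algebra_simps)
  then have b: "cmod (of_real r * cnj q - 1) \<le> cmod ?a"
    by (rule power2_le_imp_le) simp
  have "Re ?a > 0"
    using r0 q by (simp add: add_pos_pos)
  then have a0: "?a \<noteq> 0"
    by (metis less_irrefl zero_complex.sel(1))
  have s: "1 / (?x - 1) < 1" "2 * (1 / (?x - 1)) / (1 - 1 / (?x - 1)) = 2 / (?x - 2)"
  proof -
    have "2 * (1 / y) / (1 - 1 / y) = 2 / (y - 1)" if "y > 1" for y :: real
    proof -
      have "1 - 1 / y = (y - 1) / y"
        using that by (simp add: diff_divide_distrib)
      then show ?thesis
        using that by simp
    qed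
    from this[of "?x - 1"] show "1 / (?x - 1) < 1" "2 * (1 / (?x - 1)) / (1 - 1 / (?x - 1)) = 2 / (?x - 2)"
      using x by simp_all
  qed
  have "1 - gamma_r r q = 2 * A_fun ?x / (1 + A_fun ?x)"
    using A_fun_bounds(1)[OF x] by (simp add: gamma_r_def field_simps)
  then have le: "2 / (?x - 2) \<le> ln 2 * (1 - gamma_r r q)"
    using A_fun_bounds(3)[OF x] by simp
  have "\<exists>\<Lambda>. N w = ?a * exp \<Lambda> \<and> cmod \<Lambda> \<le> ln 2 * (1 - gamma_r r q)" if w: "w \<in> unit_disc" for w
  proof -
    obtain \<eta> where \<eta>: "cmod \<eta> \<le> 1 / (?x - 1)" "N w * (1 - \<eta>) = ?a + (of_real r * cnj q - 1) * \<eta>"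
      using N(4)[OF w] by blast
    obtain \<Lambda> where "N w = ?a * exp \<Lambda>" "cmod \<Lambda> \<le> 2 * (1 / (?x - 1)) / (1 - 1 / (?x - 1))"
      by (rule half_plane_quotient_exp[OF \<eta>(1) s(1) b a0 \<eta>(2)])
    then show ?thesis
      unfolding s(2) using le by (blast intro: order_trans)
  qed
  with N(1-3) show ?thesis
    by (rule that)
qed

lemma gamma_r_bounds:
  assumes "Re q > 0" "r \<ge> 6 / Re q"
  shows "0 < gamma_r r q" "gamma_r r q < 1"
proof -
  have x: "r * Re q \<ge> 6"
    using assms by (simp add: divide_le_eq)
  show "0 < gamma_r r q" "gamma_r r q < 1"
    using A_fun_bounds(1,2)[OF x] by (simp_all add: gamma_r_def)
qed

theorem theorem5p1:
  fixes q :: complex and r :: real and G :: "complex \<Rightarrow> complex"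
  assumes "Re q > 0"
    and "r \<ge> 6 / Re q"
    and "G \<in> resolvent_family r q"
  shows "(\<bar>Arg (1 + of_real r * q)\<bar> < pi * gamma_r r q / 2 \<longrightarrow>
            exponentially_squeezing (generated_semigroup G) (kappa_r r q))
         \<and> uniform_limit unit_disc (generated_semigroup G) (\<lambda>z. 0) at_top
         \<and> (\<forall>z\<in>unit_disc.
              analytically_extends_to (\<lambda>t. generated_semigroup G t z)
                (sector (Arg (1 + of_real r * q)) (pi * gamma_r r q / 2)))"
proof -
  let ?a = "1 + of_real r * q" and ?\<gamma> = "gamma_r r q" and ?u = "generated_semigroup G"
  note \<gamma> = gamma_r_bounds[OF assms(1,2)]
  have "r > 0"
    using assms(1,2) by (meson divide_pos_pos less_le_trans zero_less_numeral)
  then have "Re ?a > 0"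
    using assms(1) by (simp add: add_pos_pos)
  then have a0: "?a \<noteq> 0"
    by (metis less_irrefl zero_complex.sel(1))
  obtain N where N: "N holomorphic_on unit_disc" "\<And>w. w \<in> unit_disc \<Longrightarrow> G w = w / N w"
    "\<And>w. w \<in> unit_disc \<Longrightarrow> Re (N w) \<ge> 1"
    and \<Lambda>: "\<And>w. w \<in> unit_disc \<Longrightarrow> \<exists>\<Lambda>. N w = ?a * exp \<Lambda> \<and> cmod \<Lambda> \<le> ln 2 * (1 - ?\<gamma>)"
    using resolvent_family_quotient[OF assms] by blast
  have N0: "N w \<noteq> 0" if "w \<in> unit_disc" for w
    using N(3)[OF that] by auto
  have "(\<lambda>w. w / N w) holomorphic_on unit_disc"
    by (intro holomorphic_intros N N0)
  then have G_hol: "G holomorphic_on unit_disc"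
    by (rule holomorphic_transform) (simp add: N(2))
  have decay: "cmod (?u t z) \<le> cmod z * exp (- k * t)"
    if k: "\<And>w. w \<in> unit_disc \<Longrightarrow> Re (1 / N w) \<ge> k" and t: "t \<ge> 0" and z: "z \<in> unit_disc" for k t z
  proof -
    obtain F :: "complex \<Rightarrow> complex" where F: "cauchy_solution G z (\<lambda>t. F (of_real t))"
      using holomorphic_flow[OF N(1,3) zero_less_one N(2) z] by blast
    show ?thesis
      unfolding generated_semigroup_eq[OF G_hol F t]
      by (rule cauchy_solution_decay[OF N(2) k F t])
  qed

  have squeezing: "exponentially_squeezing ?u (kappa_r r q)" if Arg: "\<bar>Arg ?a\<bar> < pi * ?\<gamma> / 2"
    unfolding exponentially_squeezing_def
  proof (intro conjI allI impI ballI)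
    note bound = Re_inverse_lower_bound[OF a0 \<gamma> Arg _ kappa_r_def]
    show "kappa_r r q > 0"
      by (rule bound(1)[of 0]) (use \<gamma> in simp)
    show "cmod (?u t z) \<le> cmod z * exp (- kappa_r r q * t)" if "t > 0" "z \<in> unit_disc" for t z
    proof (rule decay)
      show "Re (1 / N w) \<ge> kappa_r r q" if w: "w \<in> unit_disc" for w
        using \<Lambda>[OF w] bound(2) by metis
    qed (use that in auto)
  qed

  have limit: "uniform_limit unit_disc ?u (\<lambda>z. 0) at_top"
  proof -
    define M where "M = cmod ?a * exp (ln 2 * (1 - ?\<gamma>))"
    have M: "M > 0"
      using a0 by (simp add: M_def)
    have k: "Re (1 / N w) \<ge> 1 / M\<^sup>2" if w: "w \<in> unit_disc" for w
    proof -
      obtain \<Lambda>w where \<Lambda>w: "N w = ?a * exp \<Lambda>w" "cmod \<Lambda>w \<le> ln 2 * (1 - ?\<gamma>)"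
        using \<Lambda>[OF w] by blast
      have "cmod (N w) \<le> M"
        unfolding \<Lambda>w(1) M_def norm_mult
        using norm_exp[of \<Lambda>w] \<Lambda>w(2) by (intro mult_left_mono) (auto intro: order_trans)
      then have "(cmod (N w))\<^sup>2 \<le> M\<^sup>2"
        by (intro power_mono) auto
      then have "1 / M\<^sup>2 \<le> Re (N w) / (cmod (N w))\<^sup>2"
        using N(3)[OF w] N0[OF w] by (intro frac_le) auto
      then show ?thesis
        by (simp add: Re_divide cmod_power2)
    qed
    have "((\<lambda>t. exp (- (1 / M\<^sup>2) * t)) \<longlongrightarrow> 0) at_top"
    proof -
      have "filterlim (\<lambda>t. (1 / M\<^sup>2) * t) at_top at_top"
        using M by (intro filterlim_tendsto_pos_mult_at_top[OF tendsto_const] filterlim_ident) simp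
      then have "filterlim (\<lambda>t. - (1 / M\<^sup>2 * t)) at_bot at_top"
        by (rule filterlim_uminus_at_bot_at_top[THEN filterlim_compose])
      then show ?thesis
        using filterlim_compose[OF exp_at_bot] by simp
    qed
    show ?thesis
    proof (rule uniform_limitI)
      fix e :: real assume e: "e > 0"
      have "\<forall>\<^sub>F t in at_top. exp (- (1 / M\<^sup>2) * t) < e"
        by (rule order_tendstoD(2)) fact+
      then show "\<forall>\<^sub>F t in at_top. \<forall>z\<in>unit_disc. dist (?u t z) 0 < e"
        using eventually_ge_at_top[of 0]
      proof eventually_elim
        case (elim t)
        show ?case
        proof
          fix z :: complex assume z: "z \<in> unit_disc"
          have "cmod (?u t z) \<le> cmod z * exp (- (1 / M\<^sup>2) * t)"
            by (rule decay[OF k elim(2) z])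
          also have "\<dots> \<le> 1 * exp (- (1 / M\<^sup>2) * t)"
            using z by (intro mult_right_mono) auto
          finally show "dist (?u t z) 0 < e"
            using elim(1) by simp
        qed
      qed
    qed
  qed

  have "analytically_extends_to (\<lambda>t. ?u t z) (sector (Arg ?a) (pi * ?\<gamma> / 2))" if z: "z \<in> unit_disc" for z
  proof -
    obtain \<Omega> F where \<Omega>: "open \<Omega>" "connected \<Omega>" "F holomorphic_on \<Omega>"
        "cauchy_solution G z (\<lambda>t. F (of_real t))"
      and ray: "\<And>d s. s \<ge> 0 \<Longrightarrow> (\<And>w. w \<in> unit_disc \<Longrightarrow> Re (cnj d * N w) > 0) \<Longrightarrow> of_real s * d \<in> \<Omega>"
      using holomorphic_flow[OF N(1,3) zero_less_one N(2) z] by blast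
    have "sector (Arg ?a) (pi * ?\<gamma> / 2) \<subseteq> \<Omega>"
    proof
      fix t assume t: "t \<in> sector (Arg ?a) (pi * ?\<gamma> / 2)"
      have "of_real (cmod t) * cis (Arg t) \<in> \<Omega>"
      proof (rule ray)
        fix w :: complex assume w: "w \<in> unit_disc"
        obtain \<Lambda>w where \<Lambda>w: "N w = ?a * exp \<Lambda>w" "cmod \<Lambda>w \<le> ln 2 * (1 - ?\<gamma>)"
          using \<Lambda>[OF w] by blast
        show "Re (cnj (cis (Arg t)) * N w) > 0"
          unfolding \<Lambda>w(1) by (rule Re_sector_pos[OF a0 \<gamma> _ \<Lambda>w(2)]) (use t in \<open>simp add: sector_def\<close>)
      qed simp
      then show "t \<in> \<Omega>"
        using rcis_cmod_Arg[of t] by (simp add: rcis_def)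
    qed
    moreover have "of_real t \<in> \<Omega>" if "t > 0" for t
    proof -
      have "of_real t * 1 \<in> \<Omega>"
        by (rule ray) (use that N(3) in \<open>auto intro: less_le_trans[OF zero_less_one]\<close>)
      then show ?thesis
        by simp
    qed
    moreover have "F (of_real t) = ?u t z" if "t > 0" for t
      using generated_semigroup_eq[OF G_hol \<Omega>(4), of t] that by simp
    ultimately show ?thesis
      unfolding analytically_extends_to_def using \<Omega>(1-3) by blast
  qed
  with squeezing limit show ?thesis
    by blast
qed

end
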